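(* Let $\mathcal{A}$ be a finite list in a finitely generated abelian group $\Gamma$ and let $G$ be a torsion-wise finite divisible abelian group. Then all coefficients of the $G$-Tutte polynomial $T^G_{\mathcal{A}}(x,y)$ are non-negative integers.
   Context: $G$ is torsion-wise finite if $G[d]=\{x\in G\mid dx=0\}$ is finite for all $d>0$, and divisible if multiplication by $k$ is surjective on $G$ for every positive integer $k$. For a sublist $\mathcal{S}$ (distinguished by index) $r_{\mathcal{S}}$ is the rank of $\langle\mathcal{S}\rangle$, $m(\mathcal{S};G)=\#\mathrm{Hom}((\Gamma/\langle\mathcal{S}\rangle)_{\mathrm{tor}},G)$, and $T^G_{\mathcal{A}}(x,y)=\sum_{\mathcal{S}\subset\mathcal{A}}m(\mathcal{S};G)(x-1)^{r_{\mathcal{A}}-r_{\mathcal{S}}}(y-1)^{\#\mathcal{S}-r_{\mathcal{S}}}$. *)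

theory Defs
  imports "HOL-Algebra.Algebra" "HOL-Computational_Algebra.Polynomial"
begin

definition fin_gen :: "('a, 'b) monoid_scheme \<Rightarrow> bool" where
  "fin_gen \<Gamma> \<longleftrightarrow> (\<exists>S. finite S \<and> S \<subseteq> carrier \<Gamma> \<and> generate \<Gamma> S = carrier \<Gamma>)"

definition torsionwise_finite :: "('a, 'b) monoid_scheme \<Rightarrow> bool" where
  "torsionwise_finite G \<longleftrightarrow>
     (\<forall>d::nat. d > 0 \<longrightarrow> finite {x \<in> carrier G. x [^]\<^bsub>G\<^esub> d = \<one>\<^bsub>G\<^esub>})"

definition divisible_group :: "('a, 'b) monoid_scheme \<Rightarrow> bool" where
  "divisible_group G \<longleftrightarrow>
     (\<forall>k::nat. k > 0 \<longrightarrow> (\<forall>y \<in> carrier G. \<exists>x \<in> carrier G. x [^]\<^bsub>G\<^esub> k = y))"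

definition torsion_part :: "('a, 'b) monoid_scheme \<Rightarrow> ('a, 'b) monoid_scheme" where
  "torsion_part Q = subgroup_generated Q
     {x \<in> carrier Q. \<exists>n::nat. n > 0 \<and> x [^]\<^bsub>Q\<^esub> n = \<one>\<^bsub>Q\<^esub>}"

definition Z_independent :: "('a, 'b) monoid_scheme \<Rightarrow> 'a set \<Rightarrow> bool" where
  "Z_independent H B \<longleftrightarrow> finite B \<and> B \<subseteq> carrier H \<and>
     (\<forall>n :: 'a \<Rightarrow> int. finprod H (\<lambda>b. b [^]\<^bsub>H\<^esub> n b) B = \<one>\<^bsub>H\<^esub> \<longrightarrow> (\<forall>b \<in> B. n b = 0))"

definition group_rank :: "('a, 'b) monoid_scheme \<Rightarrow> nat" where
  "group_rank H = Sup {card B | B. Z_independent H B}"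

text \<open>Sublists of A are given by sets of indices.\<close>
definition sub_gen :: "('a, 'b) monoid_scheme \<Rightarrow> 'a list \<Rightarrow> nat set \<Rightarrow> 'a set" where
  "sub_gen \<Gamma> A S = generate \<Gamma> ((!) A ` S)"

definition rk :: "('a, 'b) monoid_scheme \<Rightarrow> 'a list \<Rightarrow> nat set \<Rightarrow> nat" where
  "rk \<Gamma> A S = group_rank (subgroup_generated \<Gamma> ((!) A ` S))"

definition hom_tor :: "('a, 'b) monoid_scheme \<Rightarrow> 'a list \<Rightarrow> ('c, 'd) monoid_scheme \<Rightarrow> nat set \<Rightarrow> ('a set \<Rightarrow> 'c) set" where
  "hom_tor \<Gamma> A G S =
     (let Q = torsion_part (\<Gamma> Mod (sub_gen \<Gamma> A S))
      in hom Q G \<inter> extensional (carrier Q))"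

definition mult_m :: "('a, 'b) monoid_scheme \<Rightarrow> 'a list \<Rightarrow> ('c, 'd) monoid_scheme \<Rightarrow> nat set \<Rightarrow> nat" where
  "mult_m \<Gamma> A G S = card (hom_tor \<Gamma> A G S)"

text \<open>The G-Tutte polynomial in Z[x][y]: outer variable y, inner variable x.\<close>
definition G_tutte :: "('a, 'b) monoid_scheme \<Rightarrow> ('c, 'd) monoid_scheme \<Rightarrow> 'a list \<Rightarrow> int poly poly" where
  "G_tutte \<Gamma> G A =
     (\<Sum>S \<in> Pow {0..<length A}.
        smult (of_nat (mult_m \<Gamma> A G S) * [:-1, 1:] ^ (rk \<Gamma> A {0..<length A} - rk \<Gamma> A S))
              ([:[:-1:], 1:] ^ (card S - rk \<Gamma> A S)))"

end

(*
  Write C(S) for the saturation of <S> (elements having a positive power in <S>), which is the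
  closure operator of the matroid, and M(S) for the homomorphisms C(S) -> G that kill S, so that
  m(S;G) = #M(S).

  Deletion-contraction at an element that is neither a loop nor a coloop is additive, hence reduces
  positivity to minors (R; F, T) in which all elements of F are coloops and all elements of T are
  loops.  There let N = M(R + F), a finite abelian group.  For U <= F let Y_U be its subgroup of
  homomorphisms trivial on C(R + U), and Z_U the set of complex characters of N trivial on Y_U, so
  that #N = #Y_U * #Z_U.  Divisibility of G makes the restriction from N to C(R + U) surjective,
  which gives #{chi in N killing S} = #Y_U * m(R + U + S) for S <= T.  A gluing argument shows
  that every character zeta of N has a support A(zeta) <= F such that zeta is trivial on Y_U iff
  A(zeta) <= U.  Consequently #N times the polynomial of the minor is the product
  (SUM zeta. x^#(F - A(zeta))) * (SUM chi. y^#{t in T. chi t = 1}).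
*)
theory Submission
  imports Defs
begin

section \<open>Polynomials attached to matroids with multiplicities\<close>

text \<open>The obstacle is the shape of m on a minor of loops and coloops. Counting fibres gives
  m(R + U + S) = #kill(S) / #Y_U, where kill(S) consists of the chi in N killing S. The numerator is
  a sum of counts over the supersets of S, as the expansion at y = 1 wants, but U sits in a
  denominator. Passing to characters replaces 1 / #Y_U by #Z_U / #N, and the fixed denominator #N
  does not affect signs. What remains is to write #Z_U as a sum of counts over the subsets of U.
  This asks that Z_U and Z_V meet in Z_(U Int V), dually that Y_U and Y_V generate Y_(U Int V). The
  decisive case is that Y_(U - f) is the product of Y_U and Y_(F - f); it rests on f being a coloop
  and on extending homomorphisms into G. The multiplicative group of the complex numbers is itself
  divisible, so a single extension lemma serves both for homomorphisms into G and for producing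
  characters.\<close>

definition nonneg_coeffs :: "int poly poly \<Rightarrow> bool" where
  "nonneg_coeffs p \<longleftrightarrow> (\<forall>i j. coeff (coeff p j) i \<ge> 0)"

lemma nonneg_coeffs_0 [simp]: "nonneg_coeffs 0"
  by (simp add: nonneg_coeffs_def)

lemma nonneg_coeffs_add: "nonneg_coeffs p \<Longrightarrow> nonneg_coeffs q \<Longrightarrow> nonneg_coeffs (p + q)"
  by (simp add: nonneg_coeffs_def)

lemma nonneg_coeffs_sum: "(\<And>a. a \<in> A \<Longrightarrow> nonneg_coeffs (f a)) \<Longrightarrow> nonneg_coeffs (sum f A)"
  by (induction A rule: infinite_finite_induct) (auto intro: nonneg_coeffs_add)

lemma nonneg_coeffs_mult: "nonneg_coeffs p \<Longrightarrow> nonneg_coeffs q \<Longrightarrow> nonneg_coeffs (p * q)"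
  by (auto simp: nonneg_coeffs_def coeff_mult coeff_sum intro!: sum_nonneg)

lemma nonneg_coeffs_of_nat: "nonneg_coeffs (of_nat n)"
  by (auto simp: nonneg_coeffs_def of_nat_poly coeff_pCons split: nat.split)

lemma nonneg_coeffs_power: "nonneg_coeffs p \<Longrightarrow> nonneg_coeffs (p ^ n)"
  using nonneg_coeffs_of_nat[of 1] by (induction n) (auto intro: nonneg_coeffs_mult)

lemma nonneg_coeffs_of_nat_mult_cancel:
  assumes "n > 0" "nonneg_coeffs (of_nat n * p)" shows "nonneg_coeffs p"
  using assms by (auto simp: nonneg_coeffs_def of_nat_poly zero_le_mult_iff)

text \<open>The binomial theorem, grouped by subsets. It is applied with \<open>p\<close> = y - 1,
  so that the right side becomes a monomial in y.\<close>

lemma sum_Pow_power_card: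
  fixes p :: "'b::comm_semiring_1"
  assumes "finite D"
  shows "(\<Sum>W\<in>Pow D. p ^ card W) = (p + 1) ^ card D"
  using assms
proof (induction D)
  case (insert d D)
  have inj: "inj_on (insert d) (Pow D)" using insert.hyps by (auto simp: inj_on_def)
  have "(\<Sum>W\<in>Pow (insert d D). p ^ card W) = (\<Sum>W\<in>Pow D. p ^ card W) + (\<Sum>W\<in>insert d ` Pow D. p ^ card W)"
    unfolding Pow_insert using insert.hyps by (intro sum.union_disjoint) auto
  also have "(\<Sum>W\<in>insert d ` Pow D. p ^ card W) = (\<Sum>W\<in>Pow D. p * p ^ card W)"
    unfolding sum.reindex[OF inj] o_def
  proof (rule sum.cong)
    fix W assume "W \<in> Pow D"
    then have "finite W" "d \<notin> W" using insert.hyps finite_subset by auto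
    then show "p ^ card (insert d W) = p * p ^ card W" by simp
  qed simp
  also have "(\<Sum>W\<in>Pow D. p ^ card W) + (\<Sum>W\<in>Pow D. p * p ^ card W) = (p + 1) * (\<Sum>W\<in>Pow D. p ^ card W)"
    by (simp add: distrib_right sum_distrib_left sum.distrib add.commute)
  finally show ?case using insert by simp
qed simp

text \<open>Complements in \<open>F\<close> of the sets between \<open>A\<close> and
  \<open>F\<close> are exactly the subsets of \<open>F - A\<close>. Applied with \<open>p\<close> =
  x - 1.\<close>

lemma sum_supersets_power_card:
  fixes p :: "'b::comm_semiring_1"
  assumes "finite F" "A \<subseteq> F"
  shows "(\<Sum>U | A \<subseteq> U \<and> U \<subseteq> F. p ^ card (F - U)) = (p + 1) ^ card (F - A)"
proof -
  have "(\<Sum>U | A \<subseteq> U \<and> U \<subseteq> F. p ^ card (F - U)) = (\<Sum>W\<in>Pow (F - A). p ^ card W)"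
    by (rule sum.reindex_bij_witness[where i = "\<lambda>W. F - W" and j = "\<lambda>U. F - U"])
       (use assms in \<open>auto simp: double_diff\<close>)
  then show ?thesis using assms by (simp add: sum_Pow_power_card)
qed

text \<open>\<open>dep e S\<close> says that \<open>e\<close> lies in the closure of \<open>S\<close>. The last axiom states that, up to the factor
  \<open>N\<close>, the polynomial of a minor with coloops \<open>F\<close> and loops \<open>T\<close> is
  \<open>(\<Sum>A. a A * x ^ card (F - A)) * (\<Sum>B. b B * y ^ card B)\<close>, expanded around \<open>x = y = 1\<close>.\<close>
locale multiplicity_matroid =
  fixes E :: "'i set" and r :: "'i set \<Rightarrow> nat" and dep :: "'i \<Rightarrow> 'i set \<Rightarrow> bool"
    and m :: "'i set \<Rightarrow> nat"
  assumes finite_E: "finite E"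
    and r_insert: "\<And>e S. e \<in> E \<Longrightarrow> S \<subseteq> E \<Longrightarrow> r (insert e S) = r S + (if dep e S then 0 else 1)"
    and dep_mono: "\<And>e S S'. dep e S \<Longrightarrow> S \<subseteq> S' \<Longrightarrow> S' \<subseteq> E \<Longrightarrow> e \<in> E \<Longrightarrow> dep e S'"
    and molecule: "\<And>R F T. R \<union> F \<union> T \<subseteq> E \<Longrightarrow> (\<And>t. t \<in> T \<Longrightarrow> dep t R) \<Longrightarrow>
      (\<And>f. f \<in> F \<Longrightarrow> \<not> dep f (R \<union> (F - {f}))) \<Longrightarrow>
      \<exists>N a b. N > (0::nat) \<and> (\<forall>U\<subseteq>F. \<forall>S\<subseteq>T. N * m (R \<union> (U \<union> S)) =
        (\<Sum>A\<in>Pow U. a A) * (\<Sum>B | S \<subseteq> B \<and> B \<subseteq> T. b B))"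
begin

text \<open>The summand of \<open>S\<close> in the minor on \<open>C\<close> with \<open>R\<close>
  contracted: the exponents use relative ranks, the multiplicity is that of
  \<open>R \<union> S\<close>. In the nullity #S - (r(R + S) - r(R)), \<open>r R\<close> is added
  first to stay clear of truncated subtraction.\<close>

definition minor_term :: "'i set \<Rightarrow> 'i set \<Rightarrow> 'i set \<Rightarrow> int poly poly" where
  "minor_term R C S = smult (of_nat (m (R \<union> S)) * [:-1, 1:] ^ (r (R \<union> C) - r (R \<union> S)))
     ([:[:-1:], 1:] ^ (card S + r R - r (R \<union> S)))"

definition minor_tutte :: "'i set \<Rightarrow> 'i set \<Rightarrow> int poly poly" where
  "minor_tutte R C = (\<Sum>S\<in>Pow C. minor_term R C S)"

text \<open>With only coloops in \<open>F\<close> and loops in \<open>T\<close>, the rank of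
  \<open>R \<union> (U \<union> S)\<close> is \<open>r R + card U\<close>. The exponents become
  \<open>card (F - U)\<close> and \<open>card S\<close>, and the double sum splits into a factor
  over \<open>U\<close> and a factor over \<open>S\<close>.\<close>

lemma minor_tutte_molecule:
  assumes RFT: "R \<union> F \<union> T \<subseteq> E" and FT: "F \<inter> T = {}" "R \<inter> (F \<union> T) = {}"
    and T: "\<And>t. t \<in> T \<Longrightarrow> dep t R"
    and F: "\<And>f. f \<in> F \<Longrightarrow> \<not> dep f (R \<union> (F \<union> T - {f}))"
  shows "nonneg_coeffs (minor_tutte R (F \<union> T))"
proof -
  define p :: "int poly" where "p = [:-1, 1:]"
  define q :: "int poly poly" where "q = [:[:-1:], 1:]"
  have fin: "finite F" "finite T" using RFT finite_E finite_subset by auto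
  \<comment> \<open>The axiom \<open>molecule\<close> speaks of coloops relative to \<open>R\<close>
    and \<open>F\<close> only; leaving out \<open>T\<close> is harmless by monotonicity.\<close>
  have "\<not> dep f (R \<union> (F - {f}))" if "f \<in> F" for f
    using F[OF that] dep_mono[of f "R \<union> (F - {f})" "R \<union> (F \<union> T - {f})"] RFT that by blast
  then have "\<exists>N a b. N > (0::nat) \<and> (\<forall>U\<subseteq>F. \<forall>S\<subseteq>T. N * m (R \<union> (U \<union> S)) =
        (\<Sum>A\<in>Pow U. a A) * (\<Sum>B | S \<subseteq> B \<and> B \<subseteq> T. b B))"
    by (intro molecule RFT T)
  then obtain N a b where Nab: "N > (0::nat) \<and> (\<forall>U\<subseteq>F. \<forall>S\<subseteq>T. N * m (R \<union> (U \<union> S)) =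
        (\<Sum>A\<in>Pow U. a A) * (\<Sum>B | S \<subseteq> B \<and> B \<subseteq> T. b B))"
    by (elim exE)
  then have Nm: "N * m (R \<union> (U \<union> S)) = (\<Sum>A\<in>Pow U. a A) * (\<Sum>B | S \<subseteq> B \<and> B \<subseteq> T. b B)"
    if "U \<subseteq> F" "S \<subseteq> T" for U S
    using that by simp
  have rT: "r (R \<union> S) = r R" if "S \<subseteq> T" for S
    using finite_subset[OF that fin(2)] that
  proof (induction S)
    case (insert s S)
    then have "dep s (R \<union> S)" using T[of s] RFT dep_mono[of s R "R \<union> S"] by blast
    then show ?case using insert RFT r_insert[of s "R \<union> S"] by auto
  qed simp
  have rU: "r (R \<union> (U \<union> S)) = r R + card U" if "U \<subseteq> F" "S \<subseteq> T" for U S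
    using finite_subset[OF that(1) fin(1)] that(1)
  proof (induction U)
    case empty
    then show ?case using rT[OF that(2)] by simp
  next
    case (insert f U)
    have sub: "R \<union> (U \<union> S) \<subseteq> R \<union> (F \<union> T - {f})"
      using insert that FT by auto
    have "\<not> dep f (R \<union> (U \<union> S))"
      using F[of f] dep_mono[OF _ sub] RFT insert.prems by blast
    moreover have "f \<in> E" "R \<union> (U \<union> S) \<subseteq> E" using insert.prems that RFT by blast+
    ultimately show ?case using insert r_insert[of f "R \<union> (U \<union> S)"] by auto
  qed
  have term_eq: "minor_term R (F \<union> T) (U \<union> S) =
      of_nat (m (R \<union> (U \<union> S))) * ([:p ^ card (F - U):] * q ^ card S)" if "U \<subseteq> F" "S \<subseteq> T" for U S
  proof -
    have fUS: "finite U" "finite S" using that fin finite_subset by blast+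
    have "card (U \<union> S) = card U + card S" using that FT fUS by (intro card_Un_disjoint) auto
    then show ?thesis
      using rU[OF that] rU[of F T] that fUS
      by (simp add: minor_term_def p_def q_def card_Diff_subset of_nat_poly)
  qed
  have "of_nat N * minor_tutte R (F \<union> T) = (\<Sum>U\<in>Pow F. \<Sum>S\<in>Pow T. of_nat N * minor_term R (F \<union> T) (U \<union> S))"
  proof -
    have "minor_tutte R (F \<union> T) = (\<Sum>(U, S)\<in>Pow F \<times> Pow T. minor_term R (F \<union> T) (U \<union> S))"
      unfolding minor_tutte_def
      by (rule sum.reindex_bij_witness[where j = "\<lambda>S. (S \<inter> F, S \<inter> T)" and i = "\<lambda>(U, S). U \<union> S"])
         (use FT in \<open>auto simp: Int_Un_distrib[symmetric] Int_absorb2\<close>)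
    then show ?thesis by (simp add: sum.cartesian_product[symmetric] sum_distrib_left)
  qed
  also have "\<dots> = (\<Sum>U\<in>Pow F. \<Sum>S\<in>Pow T. (of_nat (\<Sum>A\<in>Pow U. a A) * [:p ^ card (F - U):]) *
      (of_nat (\<Sum>B | S \<subseteq> B \<and> B \<subseteq> T. b B) * q ^ card S))"
  proof (intro sum.cong refl)
    fix U S assume "U \<in> Pow F" "S \<in> Pow T"
    then have US: "U \<subseteq> F" "S \<subseteq> T" by auto
    have "of_nat N * minor_term R (F \<union> T) (U \<union> S) =
        of_nat (N * m (R \<union> (U \<union> S))) * ([:p ^ card (F - U):] * q ^ card S)"
      unfolding term_eq[OF US] by (simp only: of_nat_mult mult.assoc)
    also have "\<dots> = (of_nat (\<Sum>A\<in>Pow U. a A) * [:p ^ card (F - U):]) *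
      (of_nat (\<Sum>B | S \<subseteq> B \<and> B \<subseteq> T. b B) * q ^ card S)"
      unfolding Nm[OF US] of_nat_mult by (simp only: mult_ac)
    finally show "of_nat N * minor_term R (F \<union> T) (U \<union> S) = \<dots>" .
  qed
  also have "\<dots> = (\<Sum>U\<in>Pow F. of_nat (\<Sum>A\<in>Pow U. a A) * [:p ^ card (F - U):]) *
      (\<Sum>S\<in>Pow T. of_nat (\<Sum>B | S \<subseteq> B \<and> B \<subseteq> T. b B) * q ^ card S)"
    by (simp only: sum_product)
  also have "(\<Sum>U\<in>Pow F. of_nat (\<Sum>A\<in>Pow U. a A) * [:p ^ card (F - U):]) =
      (\<Sum>A\<in>Pow F. of_nat (a A) * ([:p:] + 1) ^ card (F - A))"
  proof -
    have "(\<Sum>U\<in>Pow F. of_nat (\<Sum>A\<in>Pow U. a A) * [:p ^ card (F - U):]) =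
      (\<Sum>U\<in>Pow F. \<Sum>A | A \<in> Pow F \<and> A \<subseteq> U. of_nat (a A) * [:p:] ^ card (F - U))"
    proof (intro sum.cong refl)
      fix U assume "U \<in> Pow F"
      then have "{A. A \<in> Pow F \<and> A \<subseteq> U} = Pow U" by auto
      then show "of_nat (\<Sum>A\<in>Pow U. a A) * [:p ^ card (F - U):] =
          (\<Sum>A | A \<in> Pow F \<and> A \<subseteq> U. of_nat (a A) * [:p:] ^ card (F - U))"
        by (simp only: of_nat_sum sum_distrib_right poly_const_pow)
    qed
    \<comment> \<open>Once the sum over \<open>U\<close> is the inner one, the sets between
      \<open>A\<close> and \<open>F\<close> add up to ((x - 1) + 1)^#(F - A), and no signs
      survive.\<close>
    also have "\<dots> = (\<Sum>A\<in>Pow F. \<Sum>U | U \<in> Pow F \<and> A \<subseteq> U. of_nat (a A) * [:p:] ^ card (F - U))"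
      using fin by (intro sum.swap_restrict) auto
    also have "\<dots> = (\<Sum>A\<in>Pow F. of_nat (a A) * (\<Sum>U | A \<subseteq> U \<and> U \<subseteq> F. [:p:] ^ card (F - U)))"
      by (intro sum.cong refl) (auto simp: sum_distrib_left intro!: sum.cong)
    finally show ?thesis using fin by (simp add: sum_supersets_power_card)
  qed
  also have "(\<Sum>S\<in>Pow T. of_nat (\<Sum>B | S \<subseteq> B \<and> B \<subseteq> T. b B) * q ^ card S) =
      (\<Sum>B\<in>Pow T. of_nat (b B) * (q + 1) ^ card B)"
  proof -
    have "(\<Sum>S\<in>Pow T. of_nat (\<Sum>B | S \<subseteq> B \<and> B \<subseteq> T. b B) * q ^ card S) =
      (\<Sum>S\<in>Pow T. \<Sum>B | B \<in> Pow T \<and> S \<subseteq> B. of_nat (b B) * q ^ card S)"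
      by (intro sum.cong refl) (auto simp: sum_distrib_right intro!: sum.cong)
    also have "\<dots> = (\<Sum>B\<in>Pow T. \<Sum>S | S \<in> Pow T \<and> S \<subseteq> B. of_nat (b B) * q ^ card S)"
      using fin by (intro sum.swap_restrict) auto
    also have "\<dots> = (\<Sum>B\<in>Pow T. of_nat (b B) * (\<Sum>S\<in>Pow B. q ^ card S))"
      by (intro sum.cong refl) (auto simp: sum_distrib_left intro!: sum.cong)
    also have "\<dots> = (\<Sum>B\<in>Pow T. of_nat (b B) * (q + 1) ^ card B)"
      using finite_subset[OF _ fin(2)] by (intro sum.cong refl) (simp add: sum_Pow_power_card)
    finally show ?thesis .
  qed
  finally have eq: "of_nat N * minor_tutte R (F \<union> T) =
    (\<Sum>A\<in>Pow F. of_nat (a A) * ([:p:] + 1) ^ card (F - A)) * (\<Sum>B\<in>Pow T. of_nat (b B) * (q + 1) ^ card B)" .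
  \<comment> \<open>These two polynomials are x and y themselves.\<close>
  have "nonneg_coeffs ([:p:] + 1)" "nonneg_coeffs (q + 1)"
    by (auto simp: nonneg_coeffs_def p_def q_def one_pCons coeff_pCons split: nat.split)
  then have "nonneg_coeffs (of_nat N * minor_tutte R (F \<union> T))"
    unfolding eq
    by (intro nonneg_coeffs_mult nonneg_coeffs_sum nonneg_coeffs_of_nat nonneg_coeffs_power)
  then show ?thesis using Nab nonneg_coeffs_of_nat_mult_cancel by blast
qed

text \<open>Split the subsets by whether they contain \<open>e\<close>. Without \<open>e\<close>,
  the total rank is the same after deletion because \<open>e\<close> depends on
  \<open>R \<union> C\<close>. With \<open>e\<close>, the extra element in the nullity is offset by
  the rank that \<open>e\<close> adds to \<open>R\<close>. Multiplicities agree because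
  \<open>m\<close> is evaluated at the same sets.\<close>

lemma minor_tutte_deletion_contraction:
  assumes RC: "R \<union> insert e C \<subseteq> E" "e \<notin> C" "R \<inter> insert e C = {}"
    and e: "\<not> dep e R" "dep e (R \<union> C)"
  shows "minor_tutte R (insert e C) = minor_tutte R C + minor_tutte (insert e R) C"
proof -
  have fin: "finite C" using RC finite_E finite_subset by auto
  have inj: "inj_on (insert e) (Pow C)" using RC by (auto simp: inj_on_def)
  have r1: "r (insert e (R \<union> C)) = r (R \<union> C)"
    using r_insert[of e "R \<union> C"] RC e by auto
  have r2: "r (insert e R) = Suc (r R)"
    using r_insert[of e R] RC e by auto
  have "minor_tutte R (insert e C) =
      (\<Sum>S\<in>Pow C. minor_term R (insert e C) S) + (\<Sum>S\<in>insert e ` Pow C. minor_term R (insert e C) S)"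
    unfolding minor_tutte_def Pow_insert using fin RC by (intro sum.union_disjoint) auto
  also have "(\<Sum>S\<in>Pow C. minor_term R (insert e C) S) = minor_tutte R C"
    unfolding minor_tutte_def minor_term_def using r1 by simp
  also have "(\<Sum>S\<in>insert e ` Pow C. minor_term R (insert e C) S) = minor_tutte (insert e R) C"
    unfolding minor_tutte_def sum.reindex[OF inj] o_def
  proof (rule sum.cong)
    fix S assume "S \<in> Pow C"
    then have "finite S" "e \<notin> S" using RC fin finite_subset by auto
    then show "minor_term R (insert e C) (insert e S) = minor_term (insert e R) C S"
      by (simp add: minor_term_def r1 r2)
  qed simp
  finally show ?thesis .
qed

text \<open>\<open>R\<close> stays arbitrary in the induction because contraction moves
  \<open>e\<close> from \<open>C\<close> into \<open>R\<close>.\<close>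

lemma nonneg_coeffs_minor_tutte:
  "R \<union> C \<subseteq> E \<Longrightarrow> R \<inter> C = {} \<Longrightarrow> nonneg_coeffs (minor_tutte R C)"
proof (induction "card C" arbitrary: R C rule: less_induct)
  case less
  have fin: "finite C" using less.prems finite_E finite_subset by auto
  show ?case
  proof (cases "\<exists>e\<in>C. \<not> dep e R \<and> dep e (R \<union> (C - {e}))")
    case True
    then obtain e where e: "e \<in> C" "\<not> dep e R" "dep e (R \<union> (C - {e}))" by blast
    have lt: "card (C - {e}) < card C" using fin e(1) by (rule card_Diff1_less)
    have "minor_tutte R C = minor_tutte R (C - {e}) + minor_tutte (insert e R) (C - {e})"
      using minor_tutte_deletion_contraction[of R e "C - {e}"] e less.prems by (simp add: insert_absorb)
    then show ?thesis
      using less.hyps[OF lt, of R] less.hyps[OF lt, of "insert e R"] less.prems e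
      by (auto intro!: nonneg_coeffs_add)
  next
    case False
    \<comment> \<open>With no element left that is neither loop nor coloop, every non-loop is a
      coloop.\<close>
    define T where "T = {e \<in> C. dep e R}"
    define F where "F = {e \<in> C. \<not> dep e R}"
    have C: "C = F \<union> T" by (auto simp: T_def F_def)
    have "nonneg_coeffs (minor_tutte R (F \<union> T))"
    proof (rule minor_tutte_molecule)
      show "\<not> dep f (R \<union> (F \<union> T - {f}))" if "f \<in> F" for f
        using False that unfolding C[symmetric] by (auto simp: F_def)
      show "dep t R" if "t \<in> T" for t
        using that by (auto simp: F_def T_def)
      show "F \<inter> T = {}" by (auto simp: F_def T_def)
    qed (use less.prems C in auto)
    then show ?thesis using C by simp
  qed
qed

end

section \<open>Saturated subgroups and rank\<close>

text \<open>In an abelian group this is the preimage of the torsion subgroup of the quotient by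
  \<open>generate G V\<close>.\<close>

definition saturation :: "('a, 'b) monoid_scheme \<Rightarrow> 'a set \<Rightarrow> 'a set" where
  "saturation G V = {g \<in> carrier G. \<exists>n::nat. n > 0 \<and> g [^]\<^bsub>G\<^esub> n \<in> generate G V}"

section \<open>Saturation as a matroid closure operator\<close>

context comm_group
begin

lemma subgroup_nat_pow_closed:
  assumes "subgroup H G" "h \<in> H" shows "h [^] (n::nat) \<in> H"
  using subgroup_int_pow_closed[OF assms, of "int n"] by (simp add: int_pow_int)

text \<open>Solving a relation for one element yields an exponent of unknown sign; taking inverses
  makes it positive.\<close>

lemma mem_saturation_iff:
  assumes "V \<subseteq> carrier G"
  shows "g \<in> saturation G V \<longleftrightarrow> g \<in> carrier G \<and> (\<exists>k::int. k \<noteq> 0 \<and> g [^] k \<in> generate G V)"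
proof
  assume "g \<in> saturation G V"
  then obtain n where g: "g \<in> carrier G" and n: "n > 0" "g [^] (n::nat) \<in> generate G V"
    by (auto simp: saturation_def)
  then have "g [^] (int n) \<in> generate G V" "int n \<noteq> 0"
    by (auto simp: int_pow_int)
  with g show "g \<in> carrier G \<and> (\<exists>k::int. k \<noteq> 0 \<and> g [^] k \<in> generate G V)" by blast
next
  assume "g \<in> carrier G \<and> (\<exists>k::int. k \<noteq> 0 \<and> g [^] k \<in> generate G V)"
  then obtain k :: int where g: "g \<in> carrier G" and k: "k \<noteq> 0" "g [^] k \<in> generate G V"
    by blast
  have "g [^] \<bar>k\<bar> \<in> generate G V"
    using k g generate_m_inv_closed[OF assms, of "g [^] k"] by (auto simp: abs_if int_pow_neg)
  then have "g [^] nat \<bar>k\<bar> \<in> generate G V"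
    by (metis abs_ge_zero int_nat_eq int_pow_int)
  with g k show "g \<in> saturation G V"
    by (auto simp: saturation_def intro!: exI[of _ "nat \<bar>k\<bar>"])
qed

lemma saturation_in_carrier: "saturation G V \<subseteq> carrier G"
  by (auto simp: saturation_def)

lemma generate_subset_saturation:
  assumes "V \<subseteq> carrier G" shows "generate G V \<subseteq> saturation G V"
  using generate_in_carrier[OF assms] by (auto simp: saturation_def intro!: exI[of _ 1])

lemma subset_saturation:
  assumes "V \<subseteq> carrier G" shows "V \<subseteq> saturation G V"
  using generate_subset_saturation[OF assms] generate.incl[of _ V G] by blast

lemma saturation_mono: "V \<subseteq> Y \<Longrightarrow> saturation G V \<subseteq> saturation G Y"
  using mono_generate[of V Y] by (auto simp: saturation_def)

lemma subgroup_saturation: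
  assumes "V \<subseteq> carrier G" shows "subgroup (saturation G V) G"
proof (rule subgroupI)
  have sg: "subgroup (generate G V) G" using generate_is_subgroup[OF assms] .
  show "saturation G V \<subseteq> carrier G" by (rule saturation_in_carrier)
  show "saturation G V \<noteq> {}"
    using generate_subset_saturation[OF assms] generate.one[of G V] by blast
  fix a assume a: "a \<in> saturation G V"
  then obtain n where an: "a \<in> carrier G" "n > 0" "a [^] (n::nat) \<in> generate G V"
    by (auto simp: saturation_def)
  then show "inv a \<in> saturation G V"
    using generate_m_inv_closed[OF assms an(3)]
    by (auto simp: saturation_def nat_pow_inv intro!: exI[of _ n])
  fix b assume b: "b \<in> saturation G V"
  then obtain m where bm: "b \<in> carrier G" "m > 0" "b [^] (m::nat) \<in> generate G V"
    by (auto simp: saturation_def)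
  have "(a \<otimes> b) [^] (n * m) = (a [^] n) [^] m \<otimes> (b [^] m) [^] n"
    using an bm by (simp add: nat_pow_distrib nat_pow_pow mult.commute)
  also have "\<dots> \<in> generate G V"
    using subgroup_nat_pow_closed[OF sg an(3)] subgroup_nat_pow_closed[OF sg bm(3)] by (intro generate.eng)
  finally show "a \<otimes> b \<in> saturation G V"
    using an bm by (auto simp: saturation_def intro!: exI[of _ "n * m"])
qed

lemma generate_subset_saturation_if:
  assumes "V \<subseteq> carrier G" "Y \<subseteq> saturation G V"
  shows "generate G Y \<subseteq> saturation G V"
  using generate_subgroup_incl[OF assms(2) subgroup_saturation[OF assms(1)]] .

lemma saturation_closed:
  assumes "V \<subseteq> carrier G" "g \<in> carrier G" "g [^] (k::int) \<in> saturation G V" "k \<noteq> 0"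
  shows "g \<in> saturation G V"
proof -
  obtain l :: int where l: "l \<noteq> 0" "(g [^] k) [^] l \<in> generate G V"
    using assms(3) mem_saturation_iff[OF assms(1)] by blast
  then have "g [^] (k * l) \<in> generate G V" using assms(2) by (simp add: int_pow_pow)
  with l assms show ?thesis using mem_saturation_iff[OF assms(1)] by (metis mult_eq_0_iff)
qed

lemma saturation_subset_saturation:
  assumes "V \<subseteq> carrier G" "Y \<subseteq> saturation G V"
  shows "saturation G Y \<subseteq> saturation G V"
proof
  fix g assume "g \<in> saturation G Y"
  then obtain n where g: "g \<in> carrier G" "n > 0" "g [^] (n::nat) \<in> generate G Y"
    by (auto simp: saturation_def)
  then have "g [^] (int n) \<in> saturation G V"
    using generate_subset_saturation_if[OF assms] by (auto simp: int_pow_int)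
  with g show "g \<in> saturation G V"
    using saturation_closed[OF assms(1) g(1), of "int n"] by auto
qed

lemma generate_Un_singletonE:
  assumes "V \<subseteq> carrier G" "e \<in> carrier G" "x \<in> generate G (insert e V)"
  obtains y and k :: int where "y \<in> generate G V" "x = y \<otimes> e [^] k"
proof -
  have sg: "subgroup (generate G V) G" using generate_is_subgroup[OF assms(1)] .
  note inc = generate_in_carrier[OF assms(1)]
  have "\<exists>y k. y \<in> generate G V \<and> x = y \<otimes> e [^] (k::int)"
    using assms(3)
  proof (induction)
    case one
    show ?case using generate.one[of G V] by (intro exI[of _ \<one>] exI[of _ 0]) auto
  next
    case (incl h)
    show ?case
    proof (cases "h = e")
      case True
      then show ?thesis using assms generate.one[of G V]
        by (intro exI[of _ \<one>] exI[of _ 1]) auto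
    next
      case False
      then show ?thesis using incl assms generate.incl[of h V G]
        by (intro exI[of _ h] exI[of _ 0]) auto
    qed
  next
    case (inv h)
    show ?case
    proof (cases "h = e")
      case True
      then show ?thesis using assms generate.one[of G V]
        by (intro exI[of _ \<one>] exI[of _ "-1"]) (auto simp: int_pow_neg)
    next
      case False
      then show ?thesis using inv assms generate.inv[of h V G]
        by (intro exI[of _ "inv h"] exI[of _ 0]) auto
    qed
  next
    case (eng h1 h2)
    then obtain y1 k1 y2 k2 where y: "y1 \<in> generate G V" "h1 = y1 \<otimes> e [^] (k1::int)"
        "y2 \<in> generate G V" "h2 = y2 \<otimes> e [^] (k2::int)"
      by blast
    then have "h1 \<otimes> h2 = (y1 \<otimes> y2) \<otimes> e [^] (k1 + k2)"
      using inc assms(2) by (simp add: int_pow_mult m_ac)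
    with y show ?case using generate.eng[of y1 G V y2] by blast
  qed
  then show thesis using that by blast
qed

text \<open>The Steinitz-Mac Lane exchange axiom. In a relation y^n = z e^k with z generated by
  \<open>V\<close>, the exponent k cannot vanish, as y would then be in the saturation of
  \<open>V\<close>; so the relation can be solved for a nonzero power of e.\<close>

lemma saturation_exchange:
  assumes V: "V \<subseteq> carrier G" and e: "e \<in> carrier G"
    and y: "y \<in> saturation G (insert e V)" "y \<notin> saturation G V"
  shows "e \<in> saturation G (insert y V)"
proof -
  have eV: "insert e V \<subseteq> carrier G" using V e by auto
  obtain n :: int where n: "y \<in> carrier G" "n \<noteq> 0" "y [^] n \<in> generate G (insert e V)"
    using y(1) mem_saturation_iff[OF eV] by blast
  have yV: "insert y V \<subseteq> carrier G" using V n by auto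
  obtain z k where z: "z \<in> generate G V" "y [^] n = z \<otimes> e [^] (k::int)"
    using generate_Un_singletonE[OF V e n(3)] .
  have zc: "z \<in> carrier G" using z generate_in_carrier[OF V] by blast
  have "k \<noteq> 0"
    using z n y(2) zc mem_saturation_iff[OF V] by fastforce
  moreover have "e [^] k = inv z \<otimes> y [^] n"
    using z(2) zc n e by (metis int_pow_closed inv_solve_left)
  moreover have "inv z \<otimes> y [^] n \<in> generate G (insert y V)"
    using generate_m_inv_closed[OF V z(1)] mono_generate[of V "insert y V"]
      subgroup_int_pow_closed[OF generate_is_subgroup[OF yV], of y n] generate.incl[of y "insert y V" G]
    by (intro generate.eng) auto
  ultimately show ?thesis using mem_saturation_iff[OF yV] e by metis
qed

text \<open>Independence in the matroid of the closure operator \<open>saturation\<close>. It avoids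
  integer combinations; agreement with \<open>Z_independent\<close> is shown below.\<close>

definition sat_indep :: "'a set \<Rightarrow> bool" where
  "sat_indep B \<longleftrightarrow> finite B \<and> B \<subseteq> carrier G \<and> (\<forall>b\<in>B. b \<notin> saturation G (B - {b}))"

lemma sat_indep_subset: "sat_indep B \<Longrightarrow> C \<subseteq> B \<Longrightarrow> sat_indep C"
  unfolding sat_indep_def by (meson Diff_mono finite_subset saturation_mono subset_eq subset_refl)

lemma sat_indep_insert:
  assumes "sat_indep B" "e \<in> carrier G" "e \<notin> saturation G B"
  shows "sat_indep (insert e B)"
  unfolding sat_indep_def
proof (intro conjI ballI)
  have B: "B \<subseteq> carrier G" using assms by (auto simp: sat_indep_def)
  have eB: "e \<notin> B" using assms subset_saturation[OF B] by auto
  show "finite (insert e B)" "insert e B \<subseteq> carrier G"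
    using assms by (auto simp: sat_indep_def)
  fix b assume b: "b \<in> insert e B"
  show "b \<notin> saturation G (insert e B - {b})"
  proof (cases "b = e")
    case True
    then show ?thesis using assms eB by auto
  next
    case False
    then have *: "insert e B - {b} = insert e (B - {b})" "insert b (B - {b}) = B" "b \<in> B"
      using b by auto
    have "b \<notin> saturation G (B - {b})" using assms * by (auto simp: sat_indep_def)
    \<comment> \<open>Otherwise exchange would put \<open>e\<close> into the saturation of
      \<open>insert b (B - {b})\<close>, which is that of \<open>B\<close>.\<close>
    then show ?thesis
      using saturation_exchange[of "B - {b}" e b] * B assms by auto
  qed
qed

text \<open>Steinitz replacement: some \<open>b\<close> outside \<open>V\<close> is traded for an
  \<open>x\<close> in \<open>V\<close> that is independent of the rest. The size is kept and
  \<open>B - V\<close> shrinks.\<close>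

lemma sat_indep_card_le:
  assumes V: "finite V" "V \<subseteq> carrier G"
  shows "sat_indep B \<Longrightarrow> B \<subseteq> saturation G V \<Longrightarrow> card B \<le> card V"
proof (induction "card (B - V)" arbitrary: B rule: less_induct)
  case less
  then have fB: "finite B" and BC: "B \<subseteq> carrier G" by (auto simp: sat_indep_def)
  show ?case
  proof (cases "B \<subseteq> V")
    case True
    then show ?thesis using V by (simp add: card_mono)
  next
    case False
    then obtain b where b: "b \<in> B" "b \<notin> V" by auto
    define C where "C = B - {b}"
    have C: "C \<subseteq> carrier G" "sat_indep C" using BC less.prems(1)
      by (auto simp: C_def intro: sat_indep_subset)
    have "b \<notin> saturation G C" using less.prems b by (auto simp: sat_indep_def C_def)
    \<comment> \<open>If \<open>C\<close> spanned \<open>V\<close>, it would also span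
      \<open>b\<close>, which lies in the saturation of \<open>V\<close>.\<close>
    then have "\<not> V \<subseteq> saturation G C"
      using saturation_subset_saturation[OF C(1)] b less.prems(2) by blast
    then obtain x where x: "x \<in> V" "x \<notin> saturation G C" by blast
    then have ind: "sat_indep (insert x C)" using sat_indep_insert[OF C(2)] V by auto
    have xC: "x \<notin> C" using x subset_saturation[OF C(1)] by auto
    have "insert x C - V \<subset> B - V" using x b by (auto simp: C_def)
    then have "card (insert x C - V) < card (B - V)" using fB by (auto intro: psubset_card_mono)
    moreover have "insert x C \<subseteq> saturation G V"
      using x subset_saturation[OF V(2)] less.prems(2) by (auto simp: C_def)
    ultimately have "card (insert x C) \<le> card V" using less.hyps ind by blast
    moreover have "card (insert x C) = card B"
      using xC card_Suc_Diff1[OF fB b(1)] fB unfolding C_def by simp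
    ultimately show ?thesis by simp
  qed
qed

section \<open>Comparison of matroid rank and group rank\<close>

lemma generate_finite_eq_finprod:
  assumes "finite B" "B \<subseteq> carrier G"
  shows "generate G B = range (\<lambda>n :: 'a \<Rightarrow> int. finprod G (\<lambda>b. b [^] n b) B)"
  using assms
proof (induction B)
  case empty
  then show ?case by (simp add: generate_empty)
next
  case (insert e B)
  then have e: "e \<in> carrier G" "B \<subseteq> carrier G" by auto
  have fp: "finprod G (\<lambda>b. b [^] n b) (insert e B) = e [^] n e \<otimes> finprod G (\<lambda>b. b [^] n b) B"
    for n :: "'a \<Rightarrow> int"
    using insert e by (intro finprod_insert) auto
  have fpc: "finprod G (\<lambda>b. b [^] n b) B \<in> carrier G" for n :: "'a \<Rightarrow> int"
    using e by (intro finprod_closed) auto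
  show ?case
  proof (intro equalityI subsetI)
    fix x assume "x \<in> generate G (insert e B)"
    then obtain y k where y: "y \<in> generate G B" "x = y \<otimes> e [^] (k::int)"
      using generate_Un_singletonE[OF e(2,1)] by metis
    then obtain n where n: "y = finprod G (\<lambda>b. b [^] (n b :: int)) B"
      using insert.IH e by auto
    define n' where "n' = n(e := k)"
    have "finprod G (\<lambda>b. b [^] n' b) B = y"
      unfolding n n'_def using insert.hyps e by (intro finprod_cong') auto
    then have "x = finprod G (\<lambda>b. b [^] n' b) (insert e B)"
      unfolding fp y(2) using fpc[of n] e n by (simp add: n'_def m_comm)
    then show "x \<in> range (\<lambda>n :: 'a \<Rightarrow> int. finprod G (\<lambda>b. b [^] n b) (insert e B))" by blast
  next
    fix x assume "x \<in> range (\<lambda>n :: 'a \<Rightarrow> int. finprod G (\<lambda>b. b [^] n b) (insert e B))"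
    then obtain n :: "'a \<Rightarrow> int" where n: "x = e [^] n e \<otimes> finprod G (\<lambda>b. b [^] n b) B"
      unfolding fp by blast
    have "finprod G (\<lambda>b. b [^] n b) B \<in> generate G B" using insert.IH e by auto
    then have "finprod G (\<lambda>b. b [^] n b) B \<in> generate G (insert e B)"
      using mono_generate[of B "insert e B"] by blast
    moreover have "e [^] n e \<in> generate G (insert e B)"
      using subgroup_int_pow_closed[OF generate_is_subgroup[OF insert.prems], of e] 
        generate.incl[of e "insert e B" G] by auto
    ultimately show "x \<in> generate G (insert e B)" unfolding n by (rule generate.eng[rotated])
  qed
qed

text \<open>A relation with nonzero coefficient at \<open>b\<close> says precisely that a nonzero
  power of \<open>b\<close> is generated by the other elements.\<close>

lemma Z_independent_iff_sat_indep: "Z_independent G B \<longleftrightarrow> sat_indep B"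
proof -
  have "(\<forall>n :: 'a \<Rightarrow> int. finprod G (\<lambda>b. b [^] n b) B = \<one> \<longrightarrow> (\<forall>b \<in> B. n b = 0)) \<longleftrightarrow>
        (\<forall>b\<in>B. b \<notin> saturation G (B - {b}))" if B: "finite B" "B \<subseteq> carrier G"
  proof -
    have rm: "finprod G (\<lambda>b. b [^] n b) B = b [^] n b \<otimes> finprod G (\<lambda>b. b [^] n b) (B - {b})"
      if "b \<in> B" for b and n :: "'a \<Rightarrow> int"
      using finprod_insert[of "B - {b}" b "\<lambda>b. b [^] n b"] B that
      by (auto simp: insert_absorb)
    have fpc: "finprod G (\<lambda>b. b [^] n b) (B - {b}) \<in> carrier G" for n :: "'a \<Rightarrow> int" and b
      using B by (intro finprod_closed) auto
    have gen: "generate G (B - {b}) = range (\<lambda>n :: 'a \<Rightarrow> int. finprod G (\<lambda>b. b [^] n b) (B - {b}))" for b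
      using B by (intro generate_finite_eq_finprod) auto
    have Bb: "B - {b} \<subseteq> carrier G" for b using B by auto
    show ?thesis
    proof (intro iffI ballI notI allI impI)
      fix b assume *: "\<forall>n :: 'a \<Rightarrow> int. finprod G (\<lambda>b. b [^] n b) B = \<one> \<longrightarrow> (\<forall>b \<in> B. n b = 0)"
        and b: "b \<in> B" "b \<in> saturation G (B - {b})"
      then obtain k :: int and n where k: "k \<noteq> 0" "b [^] k = finprod G (\<lambda>b. b [^] (n b :: int)) (B - {b})"
        using mem_saturation_iff[OF Bb] gen by blast
      define n' where "n' = n(b := - k)"
      have "finprod G (\<lambda>b. b [^] n' b) (B - {b}) = b [^] k"
        unfolding k n'_def using Bb by (intro finprod_cong') auto
      then have "finprod G (\<lambda>b. b [^] n' b) B = \<one>"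
        unfolding rm[OF b(1)] using b B by (auto simp: n'_def int_pow_neg subset_eq)
      then have "n' b = 0" using * b by blast
      then show False using k by (simp add: n'_def)
    next
      fix n :: "'a \<Rightarrow> int" and b
      assume *: "\<forall>b\<in>B. b \<notin> saturation G (B - {b})" "finprod G (\<lambda>b. b [^] n b) B = \<one>" and b: "b \<in> B"
      have bc: "b \<in> carrier G" using b B by auto
      have "b [^] n b = inv (finprod G (\<lambda>b. b [^] n b) (B - {b}))"
        by (rule inv_equality[symmetric]) (use *(2) rm[OF b] fpc bc in auto)
      then have "b [^] n b \<in> generate G (B - {b})"
        using generate_m_inv_closed[OF Bb, of "finprod G (\<lambda>b. b [^] n b) (B - {b})" b] gen by auto
      then show "n b = 0" using * b mem_saturation_iff[OF Bb] bc by blast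
    qed
  qed
  then show ?thesis unfolding Z_independent_def sat_indep_def by auto
qed

lemma generate_subgroup_generated:
  assumes "B \<subseteq> carrier (subgroup_generated G V)"
  shows "generate (subgroup_generated G V) B = generate G B"
  using generate_consistent[of B "carrier (subgroup_generated G V)"] assms
    subgroup_subgroup_generated[of V]
  by (simp add: subgroup_generated_def)

text \<open>Inside the subgroup generated by \<open>V\<close>, saturation is the trace of saturation
  in the whole group, so independence does not see the ambient group.\<close>

lemma Z_independent_subgroup_generated_iff:
  assumes "V \<subseteq> carrier G"
  shows "Z_independent (subgroup_generated G V) B \<longleftrightarrow> sat_indep B \<and> B \<subseteq> generate G V"
proof -
  let ?H = "subgroup_generated G V"
  have cH: "carrier ?H = generate G V"
    using assms by (simp add: carrier_subgroup_generated Int_absorb1)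
  interpret H: comm_group ?H by (rule abelian_subgroup_generated) (rule comm_group_axioms)
  have "saturation ?H C \<inter> generate G V = saturation G C \<inter> generate G V" if "C \<subseteq> generate G V" for C
    using that generate_incl[OF assms]
    by (auto simp: saturation_def cH generate_subgroup_generated pow_subgroup_generated)
  then have "b \<in> saturation ?H (B - {b}) \<longleftrightarrow> b \<in> saturation G (B - {b})"
    if "B \<subseteq> generate G V" "b \<in> B" for b
    using that by blast
  then show ?thesis
    unfolding H.Z_independent_iff_sat_indep H.sat_indep_def sat_indep_def
    using generate_incl[OF assms] by (auto simp: cH)
qed

text \<open>The supremum defining the rank runs over independent sets of the whole subgroup. All of
  them lie in the saturation of \<open>B\<close>, so the Steinitz bound applies and \<open>B\<close>
  attains the maximum.\<close>

lemma group_rank_eq_card: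
  assumes "V \<subseteq> carrier G" "sat_indep B" "B \<subseteq> V" "V \<subseteq> saturation G B"
  shows "group_rank (subgroup_generated G V) = card B"
proof -
  have B: "finite B" "B \<subseteq> carrier G" using assms by (auto simp: sat_indep_def)
  have "generate G V \<subseteq> saturation G B"
    using generate_subset_saturation_if[OF B(2) assms(4)] .
  then have le: "card C \<le> card B" if "sat_indep C" "C \<subseteq> generate G V" for C
    using that sat_indep_card_le[OF B] by blast
  have "B \<subseteq> generate G V" using assms(3) generate.incl[of _ V G] by blast
  then have "card B \<in> {card B | B. Z_independent (subgroup_generated G V) B}"
    using assms Z_independent_subgroup_generated_iff by blast
  then show ?thesis
    unfolding group_rank_def using le Z_independent_subgroup_generated_iff[OF assms(1)]
    by (intro cSup_eq_maximum) auto
qed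

lemma ex_basis:
  assumes "finite V" "V \<subseteq> carrier G"
  obtains B where "sat_indep B" "B \<subseteq> V" "V \<subseteq> saturation G B"
proof -
  have "\<exists>B. sat_indep B \<and> B \<subseteq> V \<and> V \<subseteq> saturation G B"
    using assms
  proof (induction V)
    case empty
    then show ?case by (auto simp: sat_indep_def)
  next
    case (insert e V)
    then obtain B where B: "sat_indep B" "B \<subseteq> V" "V \<subseteq> saturation G B" by auto
    have "insert e B \<subseteq> carrier G" using insert B by auto
    then have "insert e V \<subseteq> saturation G (insert e B)"
      using B(3) saturation_mono[of B "insert e B"] subset_saturation[of "insert e B"] by blast
    then show ?case
      using B insert sat_indep_insert[OF B(1), of e] by (cases "e \<in> saturation G B") blast+
  qed
  then show thesis using that by blast
qed

text \<open>A basis of \<open>V\<close> remains a basis if \<open>e\<close> lies in the closure, and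
  otherwise is enlarged by \<open>e\<close>. This supplies the axiom
  \<open>r_insert\<close>.\<close>

lemma group_rank_insert:
  assumes "finite V" "V \<subseteq> carrier G" "e \<in> carrier G"
  shows "group_rank (subgroup_generated G (insert e V)) =
    group_rank (subgroup_generated G V) + (if e \<in> saturation G V then 0 else 1)"
proof -
  obtain B where B: "sat_indep B" "B \<subseteq> V" "V \<subseteq> saturation G B"
    using ex_basis[OF assms(1,2)] .
  have Bc: "B \<subseteq> carrier G" "finite B" using B assms by (auto simp: sat_indep_def)
  have eq: "saturation G V = saturation G B"
    using saturation_mono[OF B(2)] saturation_subset_saturation[OF Bc(1) B(3)] by blast
  have rV: "group_rank (subgroup_generated G V) = card B"
    using group_rank_eq_card[OF assms(2) B] .
  have eV: "insert e V \<subseteq> carrier G" using assms by auto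
  show ?thesis
  proof (cases "e \<in> saturation G V")
    case True
    then show ?thesis
      using group_rank_eq_card[OF eV B(1)] B eq rV by auto
  next
    case False
    have eB: "insert e B \<subseteq> carrier G" using assms Bc by auto
    have "e \<notin> B" using False eq subset_saturation[OF Bc(1)] by auto
    moreover have "group_rank (subgroup_generated G (insert e V)) = card (insert e B)"
      using False B eq assms saturation_mono[of B "insert e B"] subset_saturation[OF eB]
      by (intro group_rank_eq_card[OF eV] sat_indep_insert) blast+
    ultimately show ?thesis using False Bc rV by simp
  qed
qed

lemma group_rank_empty: "group_rank (subgroup_generated G {}) = 0"
  using group_rank_eq_card[of "{}" "{}"] by (auto simp: sat_indep_def)

end

section \<open>Extension of homomorphisms into divisible groups\<close>

text \<open>Division with remainder; the closure hypothesis has the form of a remainder. The value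
  \<open>d = 0\<close> is allowed and occurs for the zero subgroup.\<close>

lemma int_subgroup_principal:
  fixes I :: "int set"
  assumes "I \<noteq> {}" and diff: "\<And>k l q. k \<in> I \<Longrightarrow> l \<in> I \<Longrightarrow> k - q * l \<in> I"
  obtains d :: nat where "int d \<in> I" "\<And>k. k \<in> I \<Longrightarrow> int d dvd k"
proof (cases "I \<subseteq> {0}")
  case True
  then show thesis using that[of 0] assms(1) by auto
next
  case False
  then obtain k where k: "k \<in> I" "k \<noteq> 0" by auto
  have "0 \<in> I" using diff[OF k(1) k(1), of 1] by simp
  then have "- k \<in> I" using diff[of 0 k 1] k by simp
  then have ex: "\<exists>n::nat. n > 0 \<and> int n \<in> I"
    using k by (intro exI[of _ "nat \<bar>k\<bar>"]) (auto simp: abs_if)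
  define d where "d = (LEAST n::nat. n > 0 \<and> int n \<in> I)"
  have d: "d > 0" "int d \<in> I" using LeastI_ex[OF ex] by (auto simp: d_def)
  have dmin: "n = 0" if "int n \<in> I" "n < d" for n
    using that not_less_Least[of n "\<lambda>n. n > 0 \<and> int n \<in> I"] by (auto simp: d_def)
  have "int d dvd k" if "k \<in> I" for k
  proof -
    have "k - (k div int d) * int d \<in> I" using diff that d by blast
    then have "int (nat (k mod int d)) \<in> I" using d by (simp add: minus_div_mult_eq_mod)
    moreover have "nat (k mod int d) < d" using d by (simp add: nat_less_iff)
    ultimately have "nat (k mod int d) = 0" by (rule dmin)
    then have "k mod int d \<le> 0" by simp
    moreover have "0 \<le> k mod int d" using d by simp
    ultimately show ?thesis unfolding dvd_eq_mod_eq_0 by (rule order_antisym)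
  qed
  then show thesis using that d by blast
qed

text \<open>Induction on the generators: the exponents of the new generator \<open>e\<close>
  occurring in \<open>H\<close> form a subgroup of the integers with generator \<open>d\<close>. One
  element of \<open>H\<close> realizing \<open>d\<close>, together with generators of the part of
  \<open>H\<close> not involving \<open>e\<close>, generates \<open>H\<close>.\<close>

lemma (in comm_group) subgroup_finitely_generated:
  assumes "finite C" "C \<subseteq> carrier G" "subgroup H G" "H \<subseteq> generate G C"
  obtains D where "finite D" "D \<subseteq> H" "generate G D = H"
proof -
  have "\<exists>D. finite D \<and> D \<subseteq> H \<and> generate G D = H"
    using assms
  proof (induction C arbitrary: H)
    case empty
    then have "H = {\<one>}" using subgroup.one_closed[of H G] by (auto simp: generate_empty)
    then show ?case by (intro exI[of _ "{}"]) (auto simp: generate_empty)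
  next
    case (insert e C)
    have e: "e \<in> carrier G" and C: "C \<subseteq> carrier G" using insert.prems by auto
    note sg = generate_is_subgroup[OF C]
    note inc = generate_in_carrier[OF C]
    interpret H: subgroup H G by (rule insert.prems(2))
    have "subgroup (H \<inter> generate G C) G"
      using insert.prems(2) sg by (rule subgroups_Inter_pair)
    then have "\<exists>D. finite D \<and> D \<subseteq> H \<inter> generate G C \<and> generate G D = H \<inter> generate G C"
      by (rule insert.IH[OF C]) simp
    then obtain D where D: "finite D" "D \<subseteq> H \<inter> generate G C" "generate G D = H \<inter> generate G C"
      by (elim exE conjE)
    have Dc: "D \<subseteq> carrier G" using D(2) H.subset by auto
    define I where "I = {k::int. \<exists>y\<in>generate G C. y \<otimes> e [^] k \<in> H}"
    have Isub: "k - q * l \<in> I" if k: "k \<in> I" and l: "l \<in> I" for k l q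
    proof -
      obtain y where y: "y \<in> generate G C" "y \<otimes> e [^] k \<in> H" using k by (auto simp: I_def)
      obtain z where z: "z \<in> generate G C" "z \<otimes> e [^] l \<in> H" using l by (auto simp: I_def)
      have yz: "y \<in> carrier G" "z \<in> carrier G" using y z inc by auto
      have 1: "(z \<otimes> e [^] l) [^] (- q) = z [^] (- q) \<otimes> e [^] (l * (- q))"
        using yz e by (simp add: int_pow_distrib int_pow_pow)
      have 2: "e [^] (k - q * l) = e [^] k \<otimes> e [^] (l * (- q))"
        using int_pow_mult[OF e, of k "l * (- q)"] by (simp add: mult.commute)
      have "(y \<otimes> e [^] k) \<otimes> (z \<otimes> e [^] l) [^] (- q) = (y \<otimes> z [^] (- q)) \<otimes> e [^] (k - q * l)"
        unfolding 1 2 using yz e by (simp add: m_ac)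
      moreover have "(y \<otimes> e [^] k) \<otimes> (z \<otimes> e [^] l) [^] (- q) \<in> H"
        using y(2) subgroup_int_pow_closed[OF insert.prems(2) z(2)] by (rule H.m_closed)
      moreover have "y \<otimes> z [^] (- q) \<in> generate G C"
        using y(1) subgroup_int_pow_closed[OF sg z(1)] by (rule generate.eng)
      ultimately show ?thesis unfolding I_def by auto
    qed
    have I_mem: "k \<in> I" if "y \<in> generate G C" "y \<otimes> e [^] k \<in> H" for y k
      using that by (auto simp: I_def)
    have "0 \<in> I" using generate.one[of G C] by (intro I_mem[of \<one>]) auto
    then obtain d where d: "int d \<in> I" "\<And>k. k \<in> I \<Longrightarrow> int d dvd k"
      using int_subgroup_principal[of I] Isub by blast
    obtain z where z: "z \<in> generate G C" "z \<otimes> e [^] (int d) \<in> H"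
      using d(1) by (auto simp: I_def)
    define h where "h = z \<otimes> e [^] (int d)"
    have zc: "z \<in> carrier G" "h \<in> carrier G" "h \<in> H" using z inc e by (auto simp: h_def)
    have hD: "insert h D \<subseteq> carrier G" using zc Dc by auto
    have "H \<subseteq> generate G (insert h D)"
    proof
      fix x assume x: "x \<in> H"
      then have "x \<in> generate G (insert e C)" using insert.prems(3) by auto
      then obtain y k where y: "y \<in> generate G C" "x = y \<otimes> e [^] (k::int)"
        using generate_Un_singletonE[OF C e] by metis
      have yc: "y \<in> carrier G" "x \<in> carrier G" using y inc x by auto
      have "k \<in> I" using x y I_mem by auto
      then obtain q where q: "k = int d * q" using d(2) by (auto simp: dvd_def)
      have "y = (y \<otimes> inv (z [^] q)) \<otimes> z [^] q" using yc zc by (simp add: m_assoc)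
      then have "x = ((y \<otimes> inv (z [^] q)) \<otimes> z [^] q) \<otimes> e [^] k" using y by simp
      moreover have "h [^] q = z [^] q \<otimes> e [^] k"
        unfolding h_def q using zc e by (simp add: int_pow_distrib int_pow_pow)
      ultimately have xq: "x = (y \<otimes> inv (z [^] q)) \<otimes> h [^] q"
        using m_assoc[of "y \<otimes> inv (z [^] q)" "z [^] q" "e [^] k"] yc zc e by simp
      \<comment> \<open>Dividing by \<open>h [^] q\<close> removes \<open>e\<close> and stays inside
        \<open>H\<close>, so the quotient lies in \<open>H \<inter> generate G C\<close>.\<close>
      have "y \<otimes> inv (z [^] q) = x \<otimes> inv (h [^] q)"
        unfolding xq using yc zc by (simp add: m_assoc)
      moreover have "x \<otimes> inv (h [^] q) \<in> H"
        using x subgroup_int_pow_closed[OF insert.prems(2) zc(3)] by simp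
      moreover have "y \<otimes> inv (z [^] q) \<in> generate G C"
        using y(1) generate_m_inv_closed[OF C subgroup_int_pow_closed[OF sg z(1)]] by (rule generate.eng)
      ultimately have "y \<otimes> inv (z [^] q) \<in> generate G D" using D by auto
      then have "y \<otimes> inv (z [^] q) \<in> generate G (insert h D)"
        using mono_generate[of D "insert h D"] by blast
      moreover have "h [^] q \<in> generate G (insert h D)"
        using subgroup_int_pow_closed[OF generate_is_subgroup[OF hD]] generate.incl[of h "insert h D" G]
        by simp
      ultimately show "x \<in> generate G (insert h D)" unfolding xq by (rule generate.eng)
    qed
    moreover have hDH: "insert h D \<subseteq> H" using zc D by auto
    ultimately show ?case
      using D generate_subgroup_incl[OF hDH insert.prems(2)]
      by (intro exI[of _ "insert h D"]) auto
  qed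
  then show thesis using that by blast
qed

lemma hom_eq_on_generate:
  assumes "group \<Gamma>" "group G" "subgroup K \<Gamma>"
    and f: "f \<in> hom (\<Gamma>\<lparr>carrier := K\<rparr>) G" "g \<in> hom (\<Gamma>\<lparr>carrier := K\<rparr>) G"
    and V: "V \<subseteq> K" "\<And>v. v \<in> V \<Longrightarrow> f v = g v" and x: "x \<in> generate \<Gamma> V"
  shows "f x = g x"
proof -
  interpret \<Gamma>: group \<Gamma> by fact
  interpret K: subgroup K \<Gamma> by fact
  have gK: "group (\<Gamma>\<lparr>carrier := K\<rparr>)" using K.subgroup_is_group[OF assms(1)] .
  interpret f: group_hom "\<Gamma>\<lparr>carrier := K\<rparr>" G f
    using gK assms by (simp add: group_hom_def group_hom_axioms_def)
  interpret g: group_hom "\<Gamma>\<lparr>carrier := K\<rparr>" G g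
    using gK assms by (simp add: group_hom_def group_hom_axioms_def)
  have sub: "generate \<Gamma> V \<subseteq> K" using \<Gamma>.generate_subgroup_incl[OF V(1) assms(3)] .
  show ?thesis
    using x
  proof (induction)
    case one
    then show ?case using f.hom_one g.hom_one by simp
  next
    case (inv h)
    then have "h \<in> K" using V by auto
    then show ?case
      using f.hom_inv[of h] g.hom_inv[of h] V(2)[OF inv] \<Gamma>.m_inv_consistent[OF assms(3), of h] by simp
  next
    case (eng h1 h2)
    then have "h1 \<in> K" "h2 \<in> K" using sub by auto
    then show ?case using eng f.hom_mult[of h1 h2] g.hom_mult[of h1 h2] by simp
  qed (use V in auto)
qed

lemma hom_trivial_on_generate:
  assumes "group \<Gamma>" "group G" "subgroup K \<Gamma>" "f \<in> hom (\<Gamma>\<lparr>carrier := K\<rparr>) G"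
    and "V \<subseteq> K" "\<And>v. v \<in> V \<Longrightarrow> f v = \<one>\<^bsub>G\<^esub>" "x \<in> generate \<Gamma> V"
  shows "f x = \<one>\<^bsub>G\<^esub>"
proof -
  interpret G: group G by fact
  show ?thesis
    using hom_eq_on_generate[OF assms(1-4), of "\<lambda>_. \<one>\<^bsub>G\<^esub>"] assms by (auto simp: hom_def)
qed

text \<open>The universal property of the image; a preimage is chosen, and the kernel condition
  makes the choice irrelevant. With a product for \<open>P\<close>, it defines a homomorphism on a
  sum of two subgroups.\<close>

lemma hom_factor_through_image:
  assumes "group_hom P \<Gamma> p" "group_hom P G q"
    and ker: "\<And>s. s \<in> carrier P \<Longrightarrow> p s = \<one>\<^bsub>\<Gamma>\<^esub> \<Longrightarrow> q s = \<one>\<^bsub>G\<^esub>"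
  obtains f where "f \<in> hom (\<Gamma>\<lparr>carrier := p ` carrier P\<rparr>) G" "\<And>s. s \<in> carrier P \<Longrightarrow> f (p s) = q s"
proof -
  interpret p: group_hom P \<Gamma> p by fact
  interpret q: group_hom P G q by fact
  define f where "f y = q (SOME s. s \<in> carrier P \<and> p s = y)" for y
  have f: "f (p s) = q s" if s: "s \<in> carrier P" for s
  proof -
    define t where "t = (SOME t. t \<in> carrier P \<and> p t = p s)"
    have "t \<in> carrier P \<and> p t = p s" unfolding t_def by (rule someI) (use s in auto)
    then have t: "t \<in> carrier P" "p t = p s" by auto
    have "p (t \<otimes>\<^bsub>P\<^esub> inv\<^bsub>P\<^esub> s) = \<one>\<^bsub>\<Gamma>\<^esub>" using s t by simp
    then have "q (t \<otimes>\<^bsub>P\<^esub> inv\<^bsub>P\<^esub> s) = \<one>\<^bsub>G\<^esub>" using s t ker by simp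
    then have "q t = q s" using s t q.H.inv_solve_right[of "\<one>\<^bsub>G\<^esub>" "q t" "q s"] by simp
    then show ?thesis by (simp add: f_def t_def)
  qed
  have "f \<in> hom (\<Gamma>\<lparr>carrier := p ` carrier P\<rparr>) G"
  proof (rule homI)
    fix x y assume "x \<in> carrier (\<Gamma>\<lparr>carrier := p ` carrier P\<rparr>)" "y \<in> carrier (\<Gamma>\<lparr>carrier := p ` carrier P\<rparr>)"
    then obtain s t where "s \<in> carrier P" "x = p s" "t \<in> carrier P" "y = p t" by auto
    then show "f (x \<otimes>\<^bsub>\<Gamma>\<lparr>carrier := p ` carrier P\<rparr>\<^esub> y) = f x \<otimes>\<^bsub>G\<^esub> f y"
      using f[of "s \<otimes>\<^bsub>P\<^esub> t"] by (simp add: f)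
  qed (auto simp: f)
  then show thesis using that f by blast
qed

section \<open>Extending and gluing homomorphisms of abelian groups\<close>

locale comm_group_pair = dom: comm_group \<Gamma> + cod: comm_group G
  for \<Gamma> :: "('a, 'b) monoid_scheme" and G :: "('c, 'd) monoid_scheme"
begin

text \<open>Factor (h, k) \<mapsto> f(h) w^k through (h, k) \<mapsto> h e^k on the product of
  \<open>H\<close> with the integers. A pair in the kernel has e^k = h^(-1) in \<open>H\<close>,
  where \<open>compat\<close> applies.\<close>

lemma hom_extend_element:
  assumes H: "subgroup H \<Gamma>" and f: "f \<in> hom (\<Gamma>\<lparr>carrier := H\<rparr>) G"
    and e: "e \<in> carrier \<Gamma>" and w: "w \<in> carrier G"
    and compat: "\<And>k::int. e [^]\<^bsub>\<Gamma>\<^esub> k \<in> H \<Longrightarrow> f (e [^]\<^bsub>\<Gamma>\<^esub> k) = w [^]\<^bsub>G\<^esub> k"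
  obtains K g where "subgroup K \<Gamma>" "H \<subseteq> K" "e \<in> K" "g \<in> hom (\<Gamma>\<lparr>carrier := K\<rparr>) G"
    "\<And>h. h \<in> H \<Longrightarrow> g h = f h" "g e = w"
proof -
  interpret H: subgroup H \<Gamma> by fact
  have gH: "group (\<Gamma>\<lparr>carrier := H\<rparr>)" using H.subgroup_is_group[OF dom.is_group] .
  interpret f: group_hom "\<Gamma>\<lparr>carrier := H\<rparr>" G f
    using gH f by (simp add: group_hom_def group_hom_axioms_def)
  define P where "P = \<Gamma>\<lparr>carrier := H\<rparr> \<times>\<times> integer_group"
  define p where "p = (\<lambda>(h, k). h \<otimes>\<^bsub>\<Gamma>\<^esub> e [^]\<^bsub>\<Gamma>\<^esub> (k::int))"
  define q where "q = (\<lambda>(h, k). f h \<otimes>\<^bsub>G\<^esub> w [^]\<^bsub>G\<^esub> (k::int))"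
  have gP: "group P" unfolding P_def using gH by (intro DirProd_group) auto
  have fc: "f h \<in> carrier G" if "h \<in> H" for h using f.hom_closed that by simp
  have fm: "f (h \<otimes>\<^bsub>\<Gamma>\<^esub> h') = f h \<otimes>\<^bsub>G\<^esub> f h'" if "h \<in> H" "h' \<in> H" for h h'
    using f.hom_mult that by simp
  have p: "group_hom P \<Gamma> p"
    using gP e unfolding group_hom_def group_hom_axioms_def
    by (auto simp: P_def p_def hom_def DirProd_def dom.int_pow_mult dom.m_ac)
  have q: "group_hom P G q"
    using gP w unfolding group_hom_def group_hom_axioms_def
    by (auto simp: P_def q_def hom_def DirProd_def cod.int_pow_mult cod.m_ac fc fm)
  have "q s = \<one>\<^bsub>G\<^esub>" if s: "s \<in> carrier P" "p s = \<one>\<^bsub>\<Gamma>\<^esub>" for s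
  proof -
    obtain h k where s': "s = (h, k)" "h \<in> H" using s by (cases s) (auto simp: P_def DirProd_def)
    have "inv\<^bsub>\<Gamma>\<^esub> h = e [^]\<^bsub>\<Gamma>\<^esub> k"
      using s(2) s' e by (intro dom.inv_equality) (auto simp: p_def dom.m_comm)
    then have eH: "e [^]\<^bsub>\<Gamma>\<^esub> k \<in> H" using s'(2) H.m_inv_closed by metis
    have "q s = f h \<otimes>\<^bsub>G\<^esub> f (e [^]\<^bsub>\<Gamma>\<^esub> k)" using compat[OF eH] s' by (simp add: q_def)
    also have "\<dots> = f \<one>\<^bsub>\<Gamma>\<^esub>" using fm[OF s'(2) eH] s(2) s' by (simp add: p_def)
    finally show ?thesis using f.hom_one by simp
  qed
  then obtain g where g: "g \<in> hom (\<Gamma>\<lparr>carrier := p ` carrier P\<rparr>) G"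
      "\<And>s. s \<in> carrier P \<Longrightarrow> g (p s) = q s"
    using hom_factor_through_image[OF p q] by blast
  have pH: "h = p (h, 0)" "g h = f h" "(h, 0) \<in> carrier P" if "h \<in> H" for h
    using that g(2)[of "(h, 0)"] by (auto simp: p_def q_def P_def DirProd_def fc)
  have pe: "e = p (\<one>\<^bsub>\<Gamma>\<^esub>, 1)" "g e = w" "(\<one>\<^bsub>\<Gamma>\<^esub>, 1) \<in> carrier P"
    using g(2)[of "(\<one>\<^bsub>\<Gamma>\<^esub>, 1)"] e w f.hom_one
    by (auto simp: p_def q_def P_def DirProd_def dom.int_pow_1 cod.int_pow_1)
  show thesis
  proof (rule that)
    show "subgroup (p ` carrier P) \<Gamma>" using group_hom.img_is_subgroup[OF p] .
    show "H \<subseteq> p ` carrier P" using pH by blast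
    show "e \<in> p ` carrier P" using pe by blast
    show "g \<in> hom (\<Gamma>\<lparr>carrier := p ` carrier P\<rparr>) G" by (rule g(1))
    show "g h = f h" if "h \<in> H" for h by (rule pH(2)[OF that])
    show "g e = w" by (rule pe(2))
  qed
qed

text \<open>The exponents k with e^k in \<open>H\<close> are the multiples of some d. By
  divisibility \<open>w\<close> can be taken as a d-th root of f(e^d), which fixes all other
  multiples; for d = 0 the only condition is at k = 0, and \<open>w\<close> = 1 will do.\<close>

lemma ex_compatible_value:
  assumes "divisible_group G"
    and H: "subgroup H \<Gamma>" and f: "f \<in> hom (\<Gamma>\<lparr>carrier := H\<rparr>) G" and e: "e \<in> carrier \<Gamma>"
  obtains w where "w \<in> carrier G" "\<And>k::int. e [^]\<^bsub>\<Gamma>\<^esub> k \<in> H \<Longrightarrow> f (e [^]\<^bsub>\<Gamma>\<^esub> k) = w [^]\<^bsub>G\<^esub> k"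
proof -
  interpret H: subgroup H \<Gamma> by fact
  have gH: "group (\<Gamma>\<lparr>carrier := H\<rparr>)" using H.subgroup_is_group[OF dom.is_group] .
  interpret f: group_hom "\<Gamma>\<lparr>carrier := H\<rparr>" G f
    using gH f by (simp add: group_hom_def group_hom_axioms_def)
  define I where "I = {k::int. e [^]\<^bsub>\<Gamma>\<^esub> k \<in> H}"
  have Isub: "k - q * l \<in> I" if "k \<in> I" "l \<in> I" for k q l
  proof -
    have "e [^]\<^bsub>\<Gamma>\<^esub> (k - q * l) = e [^]\<^bsub>\<Gamma>\<^esub> k \<otimes>\<^bsub>\<Gamma>\<^esub> inv\<^bsub>\<Gamma>\<^esub> ((e [^]\<^bsub>\<Gamma>\<^esub> l) [^]\<^bsub>\<Gamma>\<^esub> q)"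
      using e by (simp add: dom.int_pow_diff dom.int_pow_pow mult.commute)
    then show ?thesis using that dom.subgroup_int_pow_closed[OF H] by (simp add: I_def)
  qed
  have "0 \<in> I" by (simp add: I_def)
  then obtain d where d: "int d \<in> I" "\<And>k. k \<in> I \<Longrightarrow> int d dvd k"
    using int_subgroup_principal[of I] Isub by blast
  have ed: "e [^]\<^bsub>\<Gamma>\<^esub> int d \<in> H" using d by (simp add: I_def)
  then have fed: "f (e [^]\<^bsub>\<Gamma>\<^esub> int d) \<in> carrier G" using f.hom_closed by simp
  obtain w where w: "w \<in> carrier G" "w [^]\<^bsub>G\<^esub> d = f (e [^]\<^bsub>\<Gamma>\<^esub> int d)"
  proof (cases "d = 0")
    case True
    then show thesis using that[of "\<one>\<^bsub>G\<^esub>"] f.hom_one by simp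
  next
    case False
    then show thesis using that assms(1) fed by (auto simp: divisible_group_def)
  qed
  have "f (e [^]\<^bsub>\<Gamma>\<^esub> k) = w [^]\<^bsub>G\<^esub> k" if k: "e [^]\<^bsub>\<Gamma>\<^esub> k \<in> H" for k :: int
  proof -
    obtain q where q: "k = int d * q" using d(2)[of k] k by (auto simp: I_def)
    have "e [^]\<^bsub>\<Gamma>\<^esub> k = (e [^]\<^bsub>\<Gamma>\<^esub> int d) [^]\<^bsub>\<Gamma>\<^esub> q" using e by (simp add: q dom.int_pow_pow)
    also have "\<dots> = (e [^]\<^bsub>\<Gamma>\<^esub> int d) [^]\<^bsub>\<Gamma>\<lparr>carrier := H\<rparr>\<^esub> q"
      using dom.int_pow_consistent[OF H ed] by simp
    finally have "f (e [^]\<^bsub>\<Gamma>\<^esub> k) = f (e [^]\<^bsub>\<Gamma>\<^esub> int d) [^]\<^bsub>G\<^esub> q"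
      using f.hom_int_pow[of "e [^]\<^bsub>\<Gamma>\<^esub> int d" q] ed by simp
    also have "\<dots> = (w [^]\<^bsub>G\<^esub> int d) [^]\<^bsub>G\<^esub> q" using w by (simp add: int_pow_int)
    finally show ?thesis using w by (simp add: q cod.int_pow_pow)
  qed
  then show thesis using that w by blast
qed

text \<open>Finite generation reduces this to finitely many one-element extensions, so no maximality
  argument is needed.\<close>

lemma hom_extend:
  assumes "divisible_group G" "fin_gen \<Gamma>"
    and H: "subgroup H \<Gamma>" and f: "f \<in> hom (\<Gamma>\<lparr>carrier := H\<rparr>) G"
  obtains g where "g \<in> hom \<Gamma> G" "\<And>h. h \<in> H \<Longrightarrow> g h = f h"
proof -
  obtain C where C: "finite C" "C \<subseteq> carrier \<Gamma>" "generate \<Gamma> C = carrier \<Gamma>"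
    using assms(2) by (auto simp: fin_gen_def)
  have "\<exists>K g. subgroup K \<Gamma> \<and> H \<subseteq> K \<and> C \<subseteq> K \<and> g \<in> hom (\<Gamma>\<lparr>carrier := K\<rparr>) G \<and> (\<forall>h\<in>H. g h = f h)"
    using C(1,2)
  proof (induction C)
    case empty
    then show ?case using H f by (intro exI[of _ H] exI[of _ f]) auto
  next
    case (insert e C)
    then obtain K g where K: "subgroup K \<Gamma>" "H \<subseteq> K" "C \<subseteq> K" "g \<in> hom (\<Gamma>\<lparr>carrier := K\<rparr>) G"
      "\<forall>h\<in>H. g h = f h" by auto
    have e: "e \<in> carrier \<Gamma>" using insert.prems by auto
    obtain w where w: "w \<in> carrier G" "\<And>k::int. e [^]\<^bsub>\<Gamma>\<^esub> k \<in> K \<Longrightarrow> g (e [^]\<^bsub>\<Gamma>\<^esub> k) = w [^]\<^bsub>G\<^esub> k"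
      using ex_compatible_value[OF assms(1) K(1,4) e] by blast
    obtain K' g' where "subgroup K' \<Gamma>" "K \<subseteq> K'" "e \<in> K'" "g' \<in> hom (\<Gamma>\<lparr>carrier := K'\<rparr>) G"
      "\<And>h. h \<in> K \<Longrightarrow> g' h = g h"
      using hom_extend_element[OF K(1,4) e w] by blast
    then show ?case using K by (intro exI[of _ K'] exI[of _ g']) auto
  qed
  then obtain K g where K: "subgroup K \<Gamma>" "C \<subseteq> K" "g \<in> hom (\<Gamma>\<lparr>carrier := K\<rparr>) G" "\<forall>h\<in>H. g h = f h"
    by blast
  have "K = carrier \<Gamma>"
    using dom.generate_subgroup_incl[OF K(2,1)] C(3) subgroup.subset[OF K(1)] by auto
  then show thesis using that[of g] K by (auto simp: hom_def)
qed

text \<open>\<open>f\<close> on \<open>H\<close> and the trivial map on \<open>K\<close> agree on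
  the intersection, hence define h k \<mapsto> f(h) on the product of the subgroups; divisibility
  extends this to the whole group.\<close>

lemma hom_glue_trivial:
  assumes "divisible_group G" "fin_gen \<Gamma>"
    and H: "subgroup H \<Gamma>" and K: "subgroup K \<Gamma>" and f: "f \<in> hom (\<Gamma>\<lparr>carrier := H\<rparr>) G"
    and triv: "\<And>h. h \<in> H \<Longrightarrow> h \<in> K \<Longrightarrow> f h = \<one>\<^bsub>G\<^esub>"
  obtains g where "g \<in> hom \<Gamma> G" "\<And>h. h \<in> H \<Longrightarrow> g h = f h" "\<And>k. k \<in> K \<Longrightarrow> g k = \<one>\<^bsub>G\<^esub>"
proof -
  interpret H: subgroup H \<Gamma> by fact
  interpret K: subgroup K \<Gamma> by fact
  have gH: "group (\<Gamma>\<lparr>carrier := H\<rparr>)" using H.subgroup_is_group[OF dom.is_group] .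
  have gK: "group (\<Gamma>\<lparr>carrier := K\<rparr>)" using K.subgroup_is_group[OF dom.is_group] .
  interpret f: group_hom "\<Gamma>\<lparr>carrier := H\<rparr>" G f
    using gH f by (simp add: group_hom_def group_hom_axioms_def)
  define P where "P = \<Gamma>\<lparr>carrier := H\<rparr> \<times>\<times> \<Gamma>\<lparr>carrier := K\<rparr>"
  define p where "p = (\<lambda>(h, k). h \<otimes>\<^bsub>\<Gamma>\<^esub> k)"
  define q where "q = (\<lambda>(h, k :: 'a). f h)"
  have gP: "group P" unfolding P_def using gH gK by (intro DirProd_group)
  have fc: "f h \<in> carrier G" if "h \<in> H" for h using f.hom_closed that by simp
  have fm: "f (h \<otimes>\<^bsub>\<Gamma>\<^esub> h') = f h \<otimes>\<^bsub>G\<^esub> f h'" if "h \<in> H" "h' \<in> H" for h h'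
    using f.hom_mult that by simp
  have p: "group_hom P \<Gamma> p"
    using gP unfolding group_hom_def group_hom_axioms_def
    by (auto simp: P_def p_def hom_def DirProd_def dom.m_ac)
  have q: "group_hom P G q"
    using gP unfolding group_hom_def group_hom_axioms_def
    by (auto simp: P_def q_def hom_def DirProd_def fc fm)
  have "q s = \<one>\<^bsub>G\<^esub>" if s: "s \<in> carrier P" "p s = \<one>\<^bsub>\<Gamma>\<^esub>" for s
  proof -
    obtain h k where s': "s = (h, k)" "h \<in> H" "k \<in> K" using s by (cases s) (auto simp: P_def DirProd_def)
    have "inv\<^bsub>\<Gamma>\<^esub> k = h"
      using s(2) s' by (intro dom.inv_equality) (auto simp: p_def)
    then have "h \<in> K" using s' K.m_inv_closed by metis
    then show ?thesis using triv s' by (simp add: q_def)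
  qed
  then obtain g where g: "g \<in> hom (\<Gamma>\<lparr>carrier := p ` carrier P\<rparr>) G"
      "\<And>s. s \<in> carrier P \<Longrightarrow> g (p s) = q s"
    using hom_factor_through_image[OF p q] by blast
  obtain g' where g': "g' \<in> hom \<Gamma> G" "\<And>h. h \<in> p ` carrier P \<Longrightarrow> g' h = g h"
    using hom_extend[OF assms(1,2) group_hom.img_is_subgroup[OF p] g(1)] by blast
  have "g' (h \<otimes>\<^bsub>\<Gamma>\<^esub> k) = f h" if "h \<in> H" "k \<in> K" for h k
  proof -
    have "(h, k) \<in> carrier P" "p (h, k) = h \<otimes>\<^bsub>\<Gamma>\<^esub> k" "q (h, k) = f h"
      using that by (auto simp: p_def q_def P_def DirProd_def)
    moreover have "p (h, k) \<in> p ` carrier P" using calculation(1) by (rule imageI)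
    ultimately show ?thesis using g(2)[of "(h, k)"] g'(2)[of "p (h, k)"] by simp
  qed
  from this[of _ "\<one>\<^bsub>\<Gamma>\<^esub>"] this[of "\<one>\<^bsub>\<Gamma>\<^esub>"] show thesis
    using that[OF g'(1)] f.hom_one by auto
qed

end

section \<open>Complex characters\<close>

text \<open>All nonzero complex numbers rather than the unit circle: divisibility is then the
  existence of roots, and on a finite group the values are roots of unity anyway.\<close>

definition complex_units :: "complex monoid" where
  "complex_units = \<lparr>carrier = - {0}, monoid.mult = (*), one = 1\<rparr>"

lemma complex_units_simps [simp]:
  "carrier complex_units = - {0}" "x \<otimes>\<^bsub>complex_units\<^esub> y = x * y" "\<one>\<^bsub>complex_units\<^esub> = 1"
  by (simp_all add: complex_units_def)

lemma comm_group_complex_units: "comm_group complex_units"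
  by (rule comm_groupI) (auto intro!: bexI[of _ "inverse x" for x])

lemma nat_pow_complex_units [simp]: "x [^]\<^bsub>complex_units\<^esub> (n::nat) = x ^ n"
  by (induction n) (auto simp: nat_pow_def mult.commute)

lemma divisible_complex_units: "divisible_group complex_units"
  unfolding divisible_group_def
proof (intro allI impI ballI)
  fix k :: nat and y :: complex assume ky: "k > 0" "y \<in> carrier complex_units"
  then have "card {z. z ^ k = y} = k" by (intro card_nth_roots) auto
  then obtain z where "z ^ k = y" using ky by (metis (mono_tags) card.empty Collect_empty_eq less_irrefl)
  then show "\<exists>x\<in>carrier complex_units. x [^]\<^bsub>complex_units\<^esub> k = y"
    using ky by (intro bexI[of _ z]) auto
qed

text \<open>If the powers of \<open>x\<close> in \<open>Y\<close> are those with exponent divisible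
  by d, then d is not 1. Some \<open>w\<close> other than 1 satisfies w^d = 1; send \<open>Y\<close>
  to 1 and \<open>x\<close> to \<open>w\<close>, then extend.\<close>

lemma separating_character:
  assumes "comm_group W" "fin_gen W" "subgroup Y W" "x \<in> carrier W" "x \<notin> Y"
  obtains f where "f \<in> hom W complex_units" "\<And>y. y \<in> Y \<Longrightarrow> f y = 1" "f x \<noteq> 1"
proof -
  interpret comm_group_pair W complex_units
    using assms comm_group_complex_units by (simp add: comm_group_pair_def)
  interpret Y: subgroup Y W by fact
  define I where "I = {k::int. x [^]\<^bsub>W\<^esub> k \<in> Y}"
  have Isub: "k - q * l \<in> I" if "k \<in> I" "l \<in> I" for k q l
  proof -
    have "x [^]\<^bsub>W\<^esub> (k - q * l) = x [^]\<^bsub>W\<^esub> k \<otimes>\<^bsub>W\<^esub> inv\<^bsub>W\<^esub> ((x [^]\<^bsub>W\<^esub> l) [^]\<^bsub>W\<^esub> q)"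
      using assms by (simp add: dom.int_pow_diff dom.int_pow_pow mult.commute)
    then show ?thesis using that dom.subgroup_int_pow_closed[OF assms(3)] by (simp add: I_def)
  qed
  have "0 \<in> I" by (simp add: I_def)
  then obtain d where d: "int d \<in> I" "\<And>k. k \<in> I \<Longrightarrow> int d dvd k"
    using int_subgroup_principal[of I] Isub by blast
  have "d \<noteq> 1" using d(1) assms by (auto simp: I_def dom.int_pow_1)
  obtain w :: complex where w: "w \<noteq> 0" "w \<noteq> 1" "w ^ d = 1"
  proof (cases "d = 0")
    case True
    \<comment> \<open>Here only the zeroth power of \<open>x\<close> lies in \<open>Y\<close>, so
      any complex number other than 0 and 1 serves.\<close>
    then show thesis using that[of 2] by simp
  next
    case False
    then have "d \<ge> 2" using \<open>d \<noteq> 1\<close> by simp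
    have "card {z::complex. z ^ d = 1} = d" using False by (intro card_nth_roots) auto
    then have "\<not> {z::complex. z ^ d = 1} \<subseteq> {1}"
      using \<open>d \<ge> 2\<close> card_mono[of "{1::complex}" "{z. z ^ d = 1}"] by auto
    then obtain w :: complex where "w \<noteq> 1" "w ^ d = 1" by auto
    then show thesis using that[of w] False by (cases "w = 0") (auto simp: power_0_left)
  qed
  have "w [^]\<^bsub>complex_units\<^esub> k = 1" if k: "x [^]\<^bsub>W\<^esub> k \<in> Y" for k :: int
  proof -
    obtain q where q: "k = int d * q" using d(2)[of k] k by (auto simp: I_def)
    have "w [^]\<^bsub>complex_units\<^esub> k = (w [^]\<^bsub>complex_units\<^esub> int d) [^]\<^bsub>complex_units\<^esub> q"
      using w by (simp add: q cod.int_pow_pow)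
    also have "w [^]\<^bsub>complex_units\<^esub> int d = \<one>\<^bsub>complex_units\<^esub>"
      using w by (simp add: int_pow_int)
    finally show ?thesis using cod.int_pow_one[of q] by simp
  qed
  moreover have "(\<lambda>_. 1) \<in> hom (W\<lparr>carrier := Y\<rparr>) complex_units" by (simp add: hom_def)
  ultimately obtain K g where K: "subgroup K W" "Y \<subseteq> K" "x \<in> K" "g \<in> hom (W\<lparr>carrier := K\<rparr>) complex_units"
      "\<And>y. y \<in> Y \<Longrightarrow> g y = 1" "g x = w"
    using hom_extend_element[OF assms(3), of "\<lambda>_. 1" x w] w assms(4) by auto
  obtain f where f: "f \<in> hom W complex_units" "\<And>h. h \<in> K \<Longrightarrow> f h = g h"
    using hom_extend[OF divisible_complex_units assms(2) K(1,4)] by blast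
  show thesis
  proof (rule that[OF f(1)])
    show "f y = 1" if "y \<in> Y" for y using that K f(2)[of y] by auto
    show "f x \<noteq> 1" using K f(2)[of x] w by simp
  qed
qed

text \<open>The dual of the quotient of \<open>W\<close> by \<open>Y\<close>. Extensionality makes
  each character count once.\<close>

definition chars_trivial_on :: "('a, 'b) monoid_scheme \<Rightarrow> 'a set \<Rightarrow> ('a \<Rightarrow> complex) set" where
  "chars_trivial_on W Y = {f \<in> hom W complex_units \<inter> extensional (carrier W). \<forall>y\<in>Y. f y = 1}"

lemma finite_chars_trivial_on:
  assumes "comm_group W" "finite (carrier W)"
  shows "finite (chars_trivial_on W Y)"
proof -
  interpret W: comm_group W by fact
  have "Coset.order W > 0" using W.order_gt_0_iff_finite assms(2) by blast
  then have fin: "finite {z::complex. z ^ Coset.order W = 1}" by (intro finite_roots_unity) auto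
  have "chars_trivial_on W Y \<subseteq> carrier W \<rightarrow>\<^sub>E {z::complex. z ^ Coset.order W = 1}"
  proof
    fix f assume f: "f \<in> chars_trivial_on W Y"
    then interpret f: group_hom W complex_units f
      using comm_group_complex_units comm_group.axioms(2)
      by (auto simp: chars_trivial_on_def group_hom_def group_hom_axioms_def)
    have "f x ^ Coset.order W = 1" if x: "x \<in> carrier W" for x
      using f.hom_nat_pow[OF x, of "Coset.order W"] W.pow_order_eq_1[OF x] f.hom_one by simp
    then show "f \<in> carrier W \<rightarrow>\<^sub>E {z::complex. z ^ Coset.order W = 1}"
      using f by (auto simp: chars_trivial_on_def PiE_def)
  qed
  then show ?thesis by (rule finite_subset) (intro finite_PiE assms(2) fin)
qed

text \<open>Orthogonality: the sum of f(x) over all x in \<open>W\<close> and all characters f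
  trivial on \<open>Y\<close> is evaluated in both orders. Only the trivial character contributes in
  one order, only the x in \<open>Y\<close> in the other.\<close>

lemma card_chars_trivial_on:
  assumes W: "comm_group W" "finite (carrier W)" and Y: "subgroup Y W"
  shows "card Y * card (chars_trivial_on W Y) = card (carrier W)"
proof -
  interpret W: comm_group W by fact
  interpret Y: subgroup Y W by fact
  let ?Z = "chars_trivial_on W Y"
  have fg: "fin_gen W"
    unfolding fin_gen_def
    using assms(2) generate.incl[of _ "carrier W" W] W.generate_incl[of "carrier W"] by blast
  have finZ: "finite ?Z" using finite_chars_trivial_on[OF W] .
  have mult: "f (x \<otimes>\<^bsub>W\<^esub> y) = f x * f y" if "f \<in> ?Z" "x \<in> carrier W" "y \<in> carrier W" for f x y
    using that by (auto simp: chars_trivial_on_def hom_def)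
  have nz: "f x \<noteq> 0" if "f \<in> ?Z" "x \<in> carrier W" for f x
    using that by (auto simp: chars_trivial_on_def hom_def)
  define triv where "triv = restrict (\<lambda>_. 1::complex) (carrier W)"
  have triv: "triv \<in> ?Z" by (auto simp: triv_def chars_trivial_on_def hom_def)
  have sum_x: "(\<Sum>x\<in>carrier W. f x) = (if f = triv then of_nat (card (carrier W)) else 0)"
    if f: "f \<in> ?Z" for f
  proof (cases "f = triv")
    case True
    then show ?thesis by (simp add: triv_def)
  next
    case False
    have "\<exists>z\<in>carrier W. f z \<noteq> 1"
    proof (rule ccontr)
      assume "\<not> (\<exists>z\<in>carrier W. f z \<noteq> 1)"
      then have "f = triv"
        using f by (intro extensionalityI[of f "carrier W"]) (auto simp: triv_def chars_trivial_on_def)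
      then show False using False by simp
    qed
    then obtain z where z: "z \<in> carrier W" "f z \<noteq> 1" by blast
    \<comment> \<open>Translation by \<open>z\<close> multiplies the sum by \<open>f z\<close>,
      which is not 1, so the sum vanishes.\<close>
    have "(\<Sum>x\<in>carrier W. f x) = (\<Sum>x\<in>carrier W. f (z \<otimes>\<^bsub>W\<^esub> x))"
      by (rule sum.reindex_bij_witness[where i = "\<lambda>x. z \<otimes>\<^bsub>W\<^esub> x" and j = "\<lambda>x. inv\<^bsub>W\<^esub> z \<otimes>\<^bsub>W\<^esub> x"])
         (use z in \<open>auto simp: W.m_assoc[symmetric]\<close>)
    also have "\<dots> = f z * (\<Sum>x\<in>carrier W. f x)"
      using z f by (simp add: mult sum_distrib_left)
    finally show ?thesis using z False by simp
  qed
  have sum_f: "(\<Sum>f\<in>?Z. f x) = (if x \<in> Y then of_nat (card ?Z) else 0)"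
    if x: "x \<in> carrier W" for x
  proof (cases "x \<in> Y")
    case True
    then show ?thesis by (simp add: chars_trivial_on_def)
  next
    case False
    then obtain g0 where g0: "g0 \<in> hom W complex_units" "\<And>y. y \<in> Y \<Longrightarrow> g0 y = 1" "g0 x \<noteq> 1"
      using separating_character[OF W(1) fg Y x] by blast
    define g where "g = restrict g0 (carrier W)"
    have g: "g \<in> ?Z" "g x \<noteq> 1"
      using g0 x by (auto simp: g_def chars_trivial_on_def hom_def)
    define tw where "tw h f = restrict (\<lambda>x. h x * f x :: complex) (carrier W)" for h f
    have tw: "tw h f \<in> ?Z" if hf: "h \<in> ?Z" "f \<in> ?Z" for h f
    proof -
      have "tw h f \<in> hom W complex_units"
        by (rule homI) (use nz[OF hf(1)] nz[OF hf(2)] mult[OF hf(1)] mult[OF hf(2)] in \<open>simp_all add: tw_def\<close>)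
      moreover have "\<forall>y\<in>Y. tw h f y = 1" using hf by (simp add: tw_def chars_trivial_on_def)
      ultimately show ?thesis by (simp add: tw_def chars_trivial_on_def)
    qed
    define g' where "g' = restrict (\<lambda>x. inverse (g x)) (carrier W)"
    have "g' \<in> hom W complex_units"
      by (rule homI) (use nz[OF g(1)] mult[OF g(1)] in \<open>simp_all add: g'_def\<close>)
    moreover have "\<forall>y\<in>Y. g' y = 1" using g(1) by (simp add: g'_def chars_trivial_on_def)
    ultimately have g': "g' \<in> ?Z" by (simp add: g'_def chars_trivial_on_def)
    have inv1: "tw g (tw g' f) = f" "tw g' (tw g f) = f" if f: "f \<in> ?Z" for f
    proof -
      have ext: "f \<in> extensional (carrier W)" "tw h k \<in> extensional (carrier W)" for h k
        using f by (auto simp: chars_trivial_on_def tw_def)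
      have *: "tw g (tw g' f) z = f z" "tw g' (tw g f) z = f z" if "z \<in> carrier W" for z
        using that nz[OF g(1) that] by (simp_all add: tw_def g'_def)
      show "tw g (tw g' f) = f" by (rule extensionalityI[OF ext(2,1)]) (rule *(1))
      show "tw g' (tw g f) = f" by (rule extensionalityI[OF ext(2,1)]) (rule *(2))
    qed
    \<comment> \<open>Multiplication by \<open>g\<close> permutes the characters and multiplies
      their sum at \<open>x\<close> by \<open>g x\<close>, which is not 1.\<close>
    have "bij_betw (tw g) ?Z ?Z"
    proof (rule bij_betw_byWitness[where f' = "tw g'"])
      show "\<forall>f\<in>?Z. tw g' (tw g f) = f" by (intro ballI inv1(2))
      show "\<forall>f\<in>?Z. tw g (tw g' f) = f" by (intro ballI inv1(1))
      show "tw g ` ?Z \<subseteq> ?Z" using tw[OF g(1)] by (rule image_subsetI)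
      show "tw g' ` ?Z \<subseteq> ?Z" using tw[OF g'] by (rule image_subsetI)
    qed
    then have "(\<Sum>f\<in>?Z. f x) = (\<Sum>f\<in>?Z. (tw g f) x)"
      using sum.reindex_bij_betw[of "tw g" ?Z ?Z "\<lambda>f. f x"] by simp
    also have "\<dots> = g x * (\<Sum>f\<in>?Z. f x)"
      using x by (simp add: tw_def sum_distrib_left)
    finally show ?thesis using g False by simp
  qed
  have "of_nat (card Y * card ?Z) = (\<Sum>x\<in>carrier W. if x \<in> Y then of_nat (card ?Z) else 0 :: complex)"
    using W(2) Y.subset by (simp add: sum.If_cases Int_absorb1)
  also have "\<dots> = (\<Sum>x\<in>carrier W. \<Sum>f\<in>?Z. f x)"
    by (intro sum.cong refl) (simp add: sum_f)
  also have "\<dots> = (\<Sum>f\<in>?Z. \<Sum>x\<in>carrier W. f x)" by (rule sum.swap)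
  also have "\<dots> = (\<Sum>f\<in>?Z. if f = triv then of_nat (card (carrier W)) else 0)"
    by (intro sum.cong refl) (simp add: sum_x)
  also have "\<dots> = of_nat (card (carrier W))" using finZ triv by simp
  finally show ?thesis by (simp only: of_nat_eq_iff)
qed

section \<open>Homomorphisms on saturated subgroups\<close>

context comm_group_pair
begin

text \<open>A copy of \<open>Hom((\<Gamma>/\<langle>V\<rangle>)\<^sub>t\<^sub>o\<^sub>r, G)\<close> that avoids the quotient.\<close>
definition sat_homs :: "'a set \<Rightarrow> ('a \<Rightarrow> 'c) set" where
  "sat_homs V = {f \<in> hom (\<Gamma>\<lparr>carrier := saturation \<Gamma> V\<rparr>) G \<inter> extensional (saturation \<Gamma> V).
     \<forall>v\<in>V. f v = \<one>\<^bsub>G\<^esub>}"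

lemma sat_homs_closed: "f \<in> sat_homs V \<Longrightarrow> x \<in> saturation \<Gamma> V \<Longrightarrow> f x \<in> carrier G"
  by (auto simp: sat_homs_def hom_def)

lemma sat_homs_mult:
  "f \<in> sat_homs V \<Longrightarrow> x \<in> saturation \<Gamma> V \<Longrightarrow> y \<in> saturation \<Gamma> V \<Longrightarrow>
    f (x \<otimes>\<^bsub>\<Gamma>\<^esub> y) = f x \<otimes>\<^bsub>G\<^esub> f y"
  by (auto simp: sat_homs_def hom_def)

lemma sat_homs_trivial_on_generate:
  assumes "V \<subseteq> carrier \<Gamma>" "f \<in> sat_homs V" "x \<in> generate \<Gamma> V"
  shows "f x = \<one>\<^bsub>G\<^esub>"
proof (rule hom_trivial_on_generate[where K = "saturation \<Gamma> V" and V = V and \<Gamma> = \<Gamma>])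
  show "subgroup (saturation \<Gamma> V) \<Gamma>" by (rule dom.subgroup_saturation[OF assms(1)])
  show "V \<subseteq> saturation \<Gamma> V" by (rule dom.subset_saturation[OF assms(1)])
  show "f \<in> hom (\<Gamma>\<lparr>carrier := saturation \<Gamma> V\<rparr>) G" using assms(2) by (simp add: sat_homs_def)
  show "f v = \<one>\<^bsub>G\<^esub>" if "v \<in> V" for v using that assms(2) by (simp add: sat_homs_def)
qed (use assms in simp_all)

text \<open>The saturation has a finite generating set \<open>D\<close>, and a homomorphism is
  determined by its values there. The value at x is annihilated by an exponent n(x) carrying x into
  \<open>generate \<Gamma> V\<close>, so only finitely many values are possible.\<close>

lemma finite_sat_homs:
  assumes "fin_gen \<Gamma>" "torsionwise_finite G" "V \<subseteq> carrier \<Gamma>"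
  shows "finite (sat_homs V)"
proof -
  let ?K = "saturation \<Gamma> V"
  note sg = dom.subgroup_saturation[OF assms(3)]
  interpret K: subgroup ?K \<Gamma> by (rule sg)
  obtain C where C: "finite C" "C \<subseteq> carrier \<Gamma>" "generate \<Gamma> C = carrier \<Gamma>"
    using assms(1) by (auto simp: fin_gen_def)
  obtain D where D: "finite D" "D \<subseteq> ?K" "generate \<Gamma> D = ?K"
    using dom.subgroup_finitely_generated[OF C(1,2) sg] C(3) K.subset by metis
  have "\<exists>n::nat. n > 0 \<and> x [^]\<^bsub>\<Gamma>\<^esub> n \<in> generate \<Gamma> V" if "x \<in> D" for x
    using D(2) that unfolding saturation_def by blast
  then obtain n :: "'a \<Rightarrow> nat" where n: "\<And>x. x \<in> D \<Longrightarrow> n x > 0 \<and> x [^]\<^bsub>\<Gamma>\<^esub> n x \<in> generate \<Gamma> V"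
    by metis
  define B where "B x = {y \<in> carrier G. y [^]\<^bsub>G\<^esub> n x = \<one>\<^bsub>G\<^esub>}" for x
  have "finite (B x)" if "x \<in> D" for x
    using assms(2) n[OF that] by (simp add: torsionwise_finite_def B_def)
  then have "finite (PiE D B)" using D(1) by (intro finite_PiE)
  moreover have "(\<lambda>f. restrict f D) ` sat_homs V \<subseteq> PiE D B"
  proof (intro image_subsetI)
    fix f assume f: "f \<in> sat_homs V"
    have "group (\<Gamma>\<lparr>carrier := ?K\<rparr>)" using K.subgroup_is_group[OF dom.is_group] .
    then interpret f: group_hom "\<Gamma>\<lparr>carrier := ?K\<rparr>" G f
      using f by (simp add: group_hom_def group_hom_axioms_def sat_homs_def)
    have "f x \<in> B x" if x: "x \<in> D" for x
    proof -
      have xK: "x \<in> ?K" using x D by auto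
      have "f x [^]\<^bsub>G\<^esub> n x = f (x [^]\<^bsub>\<Gamma>\<^esub> n x)"
        using f.hom_nat_pow[of x "n x"] xK dom.nat_pow_consistent[of x "n x" ?K] by simp
      also have "\<dots> = \<one>\<^bsub>G\<^esub>"
        using sat_homs_trivial_on_generate[OF assms(3) f] n[OF x] by blast
      finally show ?thesis using sat_homs_closed[OF f xK] by (simp add: B_def)
    qed
    then show "restrict f D \<in> PiE D B" by (simp add: restrict_PiE_iff)
  qed
  ultimately have "finite ((\<lambda>f. restrict f D) ` sat_homs V)" by (rule rev_finite_subset)
  moreover have "inj_on (\<lambda>f. restrict f D) (sat_homs V)"
  proof (rule inj_onI)
    fix f g assume fg: "f \<in> sat_homs V" "g \<in> sat_homs V" "restrict f D = restrict g D"
    have eqD: "f v = g v" if "v \<in> D" for v using fg(3) that by (metis restrict_apply')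
    have hfg: "f \<in> hom (\<Gamma>\<lparr>carrier := ?K\<rparr>) G" "g \<in> hom (\<Gamma>\<lparr>carrier := ?K\<rparr>) G"
      using fg by (auto simp: sat_homs_def)
    have "f x = g x" if "x \<in> ?K" for x
      using hom_eq_on_generate[OF dom.is_group cod.is_group sg hfg D(2) eqD] that D(3) by simp
    moreover have "f \<in> extensional ?K" "g \<in> extensional ?K" using fg by (auto simp: sat_homs_def)
    ultimately show "f = g" by (metis extensionalityI)
  qed
  ultimately show ?thesis by (rule finite_imageD)
qed

text \<open>The bijection is composition with the projection, whose preimage of the torsion subgroup
  is the saturation; its inverse is factorization through the image.\<close>

lemma ex_bij_hom_torsion_part:
  assumes V: "V \<subseteq> carrier \<Gamma>"
  defines "Q \<equiv> torsion_part (\<Gamma> Mod generate \<Gamma> V)"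
  shows "\<exists>h. bij_betw h (hom Q G \<inter> extensional (carrier Q)) (sat_homs V)"
proof -
  let ?N = "generate \<Gamma> V" and ?K = "saturation \<Gamma> V"
  let ?Q = "\<Gamma> Mod ?N"
  note sg = dom.subgroup_saturation[OF V]
  interpret K: subgroup ?K \<Gamma> by (rule sg)
  note sN = dom.generate_is_subgroup[OF V]
  interpret N: normal ?N \<Gamma> using sN by (simp add: dom.normal_iff_subgroup)
  interpret Q: comm_group ?Q using dom.abelian_FactGroup[OF sN] .
  define p where "p g = ?N #>\<^bsub>\<Gamma>\<^esub> g" for g
  have p_one: "p g = ?N \<longleftrightarrow> g \<in> ?N" if "g \<in> carrier \<Gamma>" for g
    using that dom.coset_join1[OF _ that sN] dom.coset_join2[OF that sN] N.subset by (auto simp: p_def)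
  have p_mult: "p (g \<otimes>\<^bsub>\<Gamma>\<^esub> h) = p g <#>\<^bsub>\<Gamma>\<^esub> p h" if "g \<in> carrier \<Gamma>" "h \<in> carrier \<Gamma>" for g h
    using that N.rcos_sum by (simp add: p_def)
  define T where "T = {x \<in> carrier ?Q. \<exists>n::nat. n > 0 \<and> x [^]\<^bsub>?Q\<^esub> n = \<one>\<^bsub>?Q\<^esub>}"
  \<comment> \<open>This makes \<open>T\<close> a subgroup, so that
    \<open>subgroup_generated\<close> in \<open>torsion_part\<close> adds no elements to it.\<close>
  have "T = saturation ?Q {}" by (simp add: T_def saturation_def Q.generate_empty)
  then have "subgroup T ?Q" using Q.subgroup_saturation[of "{}"] by simp
  then have "generate ?Q (carrier ?Q \<inter> T) = T"
    using subgroup.carrier_subgroup_generated_subgroup carrier_subgroup_generated by metis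
  then have Q_eq: "Q = ?Q\<lparr>carrier := T\<rparr>"
    by (simp add: Q_def torsion_part_def subgroup_generated_def T_def)
  have pT: "p g \<in> T \<longleftrightarrow> g \<in> ?K" if "g \<in> carrier \<Gamma>" for g
  proof -
    have "p g \<in> carrier ?Q" using that by (simp add: carrier_FactGroup p_def)
    moreover have "p g [^]\<^bsub>?Q\<^esub> n = p (g [^]\<^bsub>\<Gamma>\<^esub> n)" for n :: nat
      using that by (simp add: p_def N.FactGroup_pow)
    ultimately show ?thesis using that unfolding T_def saturation_def by (simp add: p_one)
  qed
  have T_image: "T = p ` ?K"
  proof (intro equalityI subsetI)
    fix x assume x: "x \<in> T"
    then obtain g where "g \<in> carrier \<Gamma>" "x = p g" by (auto simp: T_def carrier_FactGroup p_def)
    then show "x \<in> p ` ?K" using pT x by auto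
  qed (use pT K.subset in auto)
  have gK: "group (\<Gamma>\<lparr>carrier := ?K\<rparr>)" using K.subgroup_is_group[OF dom.is_group] .
  have p_hom: "group_hom (\<Gamma>\<lparr>carrier := ?K\<rparr>) ?Q p"
    using gK Q.is_group p_mult K.subset
    by (auto simp: group_hom_def group_hom_axioms_def hom_def carrier_FactGroup p_def)
  define h where "h \<theta> = restrict (\<lambda>g. \<theta> (p g)) ?K" for \<theta> :: "'a set \<Rightarrow> 'c"
  have "bij_betw h (hom Q G \<inter> extensional (carrier Q)) (sat_homs V)"
  proof (intro bij_betw_imageI inj_onI equalityI subsetI)
    fix \<theta> \<theta>' assume th: "\<theta> \<in> hom Q G \<inter> extensional (carrier Q)" "\<theta>' \<in> hom Q G \<inter> extensional (carrier Q)"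
      and eq: "h \<theta> = h \<theta>'"
    have "\<theta> (p g) = \<theta>' (p g)" if "g \<in> ?K" for g
      using fun_cong[OF eq, of g] that by (simp add: h_def)
    then have "\<theta> x = \<theta>' x" if "x \<in> T" for x using that T_image by auto
    then show "\<theta> = \<theta>'" using th Q_eq by (intro extensionalityI[of \<theta> T]) auto
  next
    fix f assume "f \<in> h ` (hom Q G \<inter> extensional (carrier Q))"
    then obtain \<theta> where th: "\<theta> \<in> hom Q G" "f = h \<theta>" by blast
    have closed: "\<theta> (p g) \<in> carrier G" if "g \<in> ?K" for g
      using th(1) that T_image by (auto simp: hom_def Q_eq)
    have mult: "\<theta> (p (g \<otimes>\<^bsub>\<Gamma>\<^esub> g')) = \<theta> (p g) \<otimes>\<^bsub>G\<^esub> \<theta> (p g')" if "g \<in> ?K" "g' \<in> ?K" for g g'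
      using th(1) that T_image K.subset by (auto simp: hom_def Q_eq p_mult)
    have "\<theta> ?N = \<one>\<^bsub>G\<^esub>"
      using hom_one[OF th(1)] subgroup.subgroup_is_group[OF \<open>subgroup T ?Q\<close> Q.is_group] cod.is_group
      by (simp add: Q_eq)
    then have "\<theta> (p v) = \<one>\<^bsub>G\<^esub>" if "v \<in> V" for v
      using that V p_one[of v] generate.incl[of v V \<Gamma>] by auto
    then show "f \<in> sat_homs V"
      using th(2) closed mult dom.subset_saturation[OF V]
      by (auto simp: sat_homs_def h_def hom_def)
  next
    fix f assume f: "f \<in> sat_homs V"
    have f_hom: "group_hom (\<Gamma>\<lparr>carrier := ?K\<rparr>) G f"
      using gK f cod.is_group by (auto simp: group_hom_def group_hom_axioms_def sat_homs_def)
    have ker: "f s = \<one>\<^bsub>G\<^esub>" if "s \<in> carrier (\<Gamma>\<lparr>carrier := ?K\<rparr>)" "p s = \<one>\<^bsub>?Q\<^esub>" for s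
      using that p_one[of s] K.subset sat_homs_trivial_on_generate[OF V f] by auto
    obtain \<theta> where th: "\<theta> \<in> hom (?Q\<lparr>carrier := p ` carrier (\<Gamma>\<lparr>carrier := ?K\<rparr>)\<rparr>) G"
      "\<And>s. s \<in> carrier (\<Gamma>\<lparr>carrier := ?K\<rparr>) \<Longrightarrow> \<theta> (p s) = f s"
      using hom_factor_through_image[OF p_hom f_hom ker] by blast
    have th_hom: "\<theta> \<in> hom Q G" using th(1) by (simp add: Q_eq T_image)
    have gQ: "group Q"
      using subgroup.subgroup_is_group[OF \<open>subgroup T ?Q\<close> Q.is_group] by (simp add: Q_eq)
    define \<theta>' where "\<theta>' = restrict \<theta> (carrier Q)"
    have "\<theta>' \<in> hom Q G"
      using th_hom gQ group.is_monoid[OF gQ] monoid.m_closed[of Q] by (auto simp: \<theta>'_def hom_def)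
    moreover have "h \<theta>' = f"
    proof (rule extensionalityI[of _ ?K])
      fix x assume x: "x \<in> ?K"
      then have "p x \<in> carrier Q" by (simp add: Q_eq T_image)
      then show "h \<theta>' x = f x" using x th(2)[of x] by (simp add: h_def \<theta>'_def)
    qed (use f in \<open>auto simp: h_def sat_homs_def\<close>)
    ultimately show "f \<in> h ` (hom Q G \<inter> extensional (carrier Q))"
      by (intro image_eqI[of _ _ \<theta>']) (auto simp: \<theta>'_def)
  qed
  then show ?thesis by blast
qed

end

lemma card_eq_sum_fibers:
  assumes "finite Z" "finite P"
  shows "card {z \<in> Z. g z \<in> P} = (\<Sum>A\<in>P. card {z \<in> Z. g z = A})"
proof -
  have "{z \<in> Z. g z \<in> P} = (\<Union>A\<in>P. {z \<in> Z. g z = A})" by auto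
  moreover have "card (\<Union>A\<in>P. {z \<in> Z. g z = A}) = (\<Sum>A\<in>P. card {z \<in> Z. g z = A})"
    using assms by (intro card_UN_disjoint) auto
  ultimately show ?thesis by simp
qed

section \<open>The group structure on \<open>sat_homs\<close> by pointwise products\<close>

context comm_group_pair
begin

definition sat_hom_group :: "'a set \<Rightarrow> ('a \<Rightarrow> 'c) monoid" where
  "sat_hom_group V = \<lparr>carrier = sat_homs V,
     monoid.mult = (\<lambda>f g. restrict (\<lambda>x. f x \<otimes>\<^bsub>G\<^esub> g x) (saturation \<Gamma> V)),
     one = restrict (\<lambda>_. \<one>\<^bsub>G\<^esub>) (saturation \<Gamma> V)\<rparr>"

lemma carrier_sat_hom_group [simp]: "carrier (sat_hom_group V) = sat_homs V"
  by (simp add: sat_hom_group_def)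

lemma mult_sat_hom_group:
  "x \<in> saturation \<Gamma> V \<Longrightarrow> (f \<otimes>\<^bsub>sat_hom_group V\<^esub> g) x = f x \<otimes>\<^bsub>G\<^esub> g x"
  by (simp add: sat_hom_group_def)

lemma one_sat_hom_group: "x \<in> saturation \<Gamma> V \<Longrightarrow> \<one>\<^bsub>sat_hom_group V\<^esub> x = \<one>\<^bsub>G\<^esub>"
  by (simp add: sat_hom_group_def)

lemma sat_homsI:
  assumes V: "V \<subseteq> carrier \<Gamma>"
    and "\<And>x. x \<in> saturation \<Gamma> V \<Longrightarrow> f x \<in> carrier G"
    and "\<And>x y. x \<in> saturation \<Gamma> V \<Longrightarrow> y \<in> saturation \<Gamma> V \<Longrightarrow> f (x \<otimes>\<^bsub>\<Gamma>\<^esub> y) = f x \<otimes>\<^bsub>G\<^esub> f y"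
    and "\<And>v. v \<in> V \<Longrightarrow> f v = \<one>\<^bsub>G\<^esub>"
  shows "restrict f (saturation \<Gamma> V) \<in> sat_homs V"
proof -
  have "x \<otimes>\<^bsub>\<Gamma>\<^esub> y \<in> saturation \<Gamma> V" if "x \<in> saturation \<Gamma> V" "y \<in> saturation \<Gamma> V" for x y
    using that subgroup.m_closed[OF dom.subgroup_saturation[OF V]] by blast
  then have "restrict f (saturation \<Gamma> V) \<in> hom (\<Gamma>\<lparr>carrier := saturation \<Gamma> V\<rparr>) G"
    using assms(2,3) by (intro homI) simp_all
  moreover have "v \<in> saturation \<Gamma> V" if "v \<in> V" for v
    using that dom.subset_saturation[OF V] by blast
  ultimately show ?thesis using assms(4) by (simp add: sat_homs_def)
qed

lemma sat_homs_eqI: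
  assumes "f \<in> sat_homs V" "g \<in> sat_homs V" "\<And>x. x \<in> saturation \<Gamma> V \<Longrightarrow> f x = g x"
  shows "f = g"
  using assms extensionalityI[of f "saturation \<Gamma> V" g] by (simp add: sat_homs_def)

lemma comm_group_sat_hom_group:
  assumes V: "V \<subseteq> carrier \<Gamma>"
  shows "comm_group (sat_hom_group V)"
proof -
  have VC: "v \<in> saturation \<Gamma> V" if "v \<in> V" for v
    using that dom.subset_saturation[OF V] by blast
  have triv: "f v = \<one>\<^bsub>G\<^esub>" if "f \<in> sat_homs V" "v \<in> V" for f v
    using that by (simp add: sat_homs_def)
  have mult: "f \<otimes>\<^bsub>sat_hom_group V\<^esub> g \<in> sat_homs V" if fg: "f \<in> sat_homs V" "g \<in> sat_homs V" for f g
  proof -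
    have "restrict (\<lambda>x. f x \<otimes>\<^bsub>G\<^esub> g x) (saturation \<Gamma> V) \<in> sat_homs V"
    proof (rule sat_homsI[OF V])
      fix x y assume "x \<in> saturation \<Gamma> V" "y \<in> saturation \<Gamma> V"
      then show "f (x \<otimes>\<^bsub>\<Gamma>\<^esub> y) \<otimes>\<^bsub>G\<^esub> g (x \<otimes>\<^bsub>\<Gamma>\<^esub> y) = f x \<otimes>\<^bsub>G\<^esub> g x \<otimes>\<^bsub>G\<^esub> (f y \<otimes>\<^bsub>G\<^esub> g y)"
        using sat_homs_mult[OF fg(1)] sat_homs_mult[OF fg(2)] sat_homs_closed[OF fg(1)]
          sat_homs_closed[OF fg(2)] by (simp add: cod.m_ac)
    qed (use sat_homs_closed[OF fg(1)] sat_homs_closed[OF fg(2)] triv[OF fg(1)] triv[OF fg(2)] in simp_all)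
    then show ?thesis by (simp add: sat_hom_group_def)
  qed
  have one: "\<one>\<^bsub>sat_hom_group V\<^esub> \<in> sat_homs V"
    using sat_homsI[OF V, of "\<lambda>_. \<one>\<^bsub>G\<^esub>"] by (simp add: sat_hom_group_def)
  show ?thesis
  proof (rule comm_groupI; unfold carrier_sat_hom_group)
    fix f g h assume fgh: "f \<in> sat_homs V" "g \<in> sat_homs V" "h \<in> sat_homs V"
    show "f \<otimes>\<^bsub>sat_hom_group V\<^esub> g \<otimes>\<^bsub>sat_hom_group V\<^esub> h = f \<otimes>\<^bsub>sat_hom_group V\<^esub> (g \<otimes>\<^bsub>sat_hom_group V\<^esub> h)"
    proof (rule sat_homs_eqI)
      fix x assume x: "x \<in> saturation \<Gamma> V"
      show "(f \<otimes>\<^bsub>sat_hom_group V\<^esub> g \<otimes>\<^bsub>sat_hom_group V\<^esub> h) x = (f \<otimes>\<^bsub>sat_hom_group V\<^esub> (g \<otimes>\<^bsub>sat_hom_group V\<^esub> h)) x"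
        using x sat_homs_closed[OF fgh(1) x] sat_homs_closed[OF fgh(2) x] sat_homs_closed[OF fgh(3) x]
        by (simp add: mult_sat_hom_group cod.m_assoc)
    qed (intro mult fgh)+
  next
    fix f g assume fg: "f \<in> sat_homs V" "g \<in> sat_homs V"
    show "f \<otimes>\<^bsub>sat_hom_group V\<^esub> g = g \<otimes>\<^bsub>sat_hom_group V\<^esub> f"
    proof (rule sat_homs_eqI)
      fix x assume x: "x \<in> saturation \<Gamma> V"
      show "(f \<otimes>\<^bsub>sat_hom_group V\<^esub> g) x = (g \<otimes>\<^bsub>sat_hom_group V\<^esub> f) x"
        using x sat_homs_closed[OF fg(1) x] sat_homs_closed[OF fg(2) x]
        by (simp add: mult_sat_hom_group cod.m_comm)
    qed (intro mult fg)+
  next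
    fix f assume f: "f \<in> sat_homs V"
    show "\<one>\<^bsub>sat_hom_group V\<^esub> \<otimes>\<^bsub>sat_hom_group V\<^esub> f = f"
    proof (rule sat_homs_eqI)
      fix x assume x: "x \<in> saturation \<Gamma> V"
      show "(\<one>\<^bsub>sat_hom_group V\<^esub> \<otimes>\<^bsub>sat_hom_group V\<^esub> f) x = f x"
        using x sat_homs_closed[OF f x] by (simp add: mult_sat_hom_group one_sat_hom_group)
    qed (intro mult one f)+
    let ?g = "restrict (\<lambda>x. inv\<^bsub>G\<^esub> f x) (saturation \<Gamma> V)"
    have g: "?g \<in> sat_homs V"
      using sat_homs_closed[OF f] sat_homs_mult[OF f] triv[OF f] by (intro sat_homsI[OF V]) (simp_all add: cod.inv_mult)
    moreover have "?g \<otimes>\<^bsub>sat_hom_group V\<^esub> f = \<one>\<^bsub>sat_hom_group V\<^esub>"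
    proof (rule sat_homs_eqI)
      fix x assume x: "x \<in> saturation \<Gamma> V"
      show "(?g \<otimes>\<^bsub>sat_hom_group V\<^esub> f) x = \<one>\<^bsub>sat_hom_group V\<^esub> x"
        using x sat_homs_closed[OF f x] by (simp add: mult_sat_hom_group one_sat_hom_group)
    qed (intro mult one f g)+
    ultimately show "\<exists>g\<in>sat_homs V. g \<otimes>\<^bsub>sat_hom_group V\<^esub> f = \<one>\<^bsub>sat_hom_group V\<^esub>" by blast
  qed (intro mult one | assumption)+
qed

lemma inv_sat_hom_group:
  assumes "V \<subseteq> carrier \<Gamma>" "f \<in> sat_homs V" "x \<in> saturation \<Gamma> V"
  shows "(inv\<^bsub>sat_hom_group V\<^esub> f) x = inv\<^bsub>G\<^esub> (f x)"
proof -
  interpret W: comm_group "sat_hom_group V" using comm_group_sat_hom_group[OF assms(1)] .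
  have inv: "inv\<^bsub>sat_hom_group V\<^esub> f \<in> sat_homs V" using W.inv_closed assms(2) by simp
  have "inv\<^bsub>sat_hom_group V\<^esub> f \<otimes>\<^bsub>sat_hom_group V\<^esub> f = \<one>\<^bsub>sat_hom_group V\<^esub>"
    using W.l_inv assms(2) by simp
  then have "(inv\<^bsub>sat_hom_group V\<^esub> f) x \<otimes>\<^bsub>G\<^esub> f x = \<one>\<^bsub>G\<^esub>"
    using mult_sat_hom_group[OF assms(3)] one_sat_hom_group[OF assms(3)] by metis
  then show ?thesis
    using cod.inv_equality sat_homs_closed[OF inv assms(3)] sat_homs_closed[OF assms(2,3)] by metis
qed

end

section \<open>Minors consisting of loops and coloops\<close>

locale molecule_homs = comm_group_pair \<Gamma> G
  for \<Gamma> :: "('a, 'b) monoid_scheme" and G :: "('c, 'd) monoid_scheme" +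
  fixes a :: "'i \<Rightarrow> 'a" and R F T :: "'i set"
  assumes fg: "fin_gen \<Gamma>" and tf: "torsionwise_finite G" and dv: "divisible_group G"
    and finite_F: "finite F" and finite_T: "finite T"
    and in_carrier: "a ` (R \<union> F \<union> T) \<subseteq> carrier \<Gamma>"
    and loops: "\<And>t. t \<in> T \<Longrightarrow> a t \<in> saturation \<Gamma> (a ` R)"
    and coloops: "\<And>f. f \<in> F \<Longrightarrow> a f \<notin> saturation \<Gamma> (a ` (R \<union> (F - {f})))"
begin

text \<open>\<open>R\<close> is tacitly included everywhere. In the notation of the overview,
  \<open>M\<close> with its group structure \<open>W\<close> is N; below,
  \<open>annihilator U\<close> is Y_U and \<open>char_support\<close> is the support.\<close>

abbreviation gen :: "'i set \<Rightarrow> 'a set" where "gen U \<equiv> generate \<Gamma> (a ` (R \<union> U))"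
abbreviation sat :: "'i set \<Rightarrow> 'a set" where "sat U \<equiv> saturation \<Gamma> (a ` (R \<union> U))"
abbreviation W :: "('a \<Rightarrow> 'c) monoid" where "W \<equiv> sat_hom_group (a ` (R \<union> F))"
abbreviation M :: "('a \<Rightarrow> 'c) set" where "M \<equiv> sat_homs (a ` (R \<union> F))"

lemma image_in_carrier: "U \<subseteq> F \<Longrightarrow> a ` (R \<union> U) \<subseteq> carrier \<Gamma>"
  using in_carrier by blast

lemma sat_mono: "U \<subseteq> U' \<Longrightarrow> sat U \<subseteq> sat U'"
  by (intro dom.saturation_mono image_mono) blast

lemma gen_mono: "U \<subseteq> U' \<Longrightarrow> gen U \<subseteq> gen U'"
  by (intro dom.mono_generate image_mono) blast

lemma gen_subset_sat: "U \<subseteq> F \<Longrightarrow> gen U \<subseteq> sat U"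
  by (intro dom.generate_subset_saturation image_in_carrier)

lemma subgroup_sat: "U \<subseteq> F \<Longrightarrow> subgroup (sat U) \<Gamma>"
  by (intro dom.subgroup_saturation image_in_carrier)

lemma subgroup_gen: "U \<subseteq> F \<Longrightarrow> subgroup (gen U) \<Gamma>"
  by (intro dom.generate_is_subgroup image_in_carrier)

text \<open>If \<open>y\<close> depended on \<open>U\<close> but not on \<open>U - {f}\<close>,
  exchange would express \<open>f\<close> through \<open>y\<close> and \<open>U - {f}\<close>, all
  inside the closure of \<open>F - {f}\<close>, against \<open>f\<close> being a coloop.\<close>

lemma sat_Diff_singleton:
  assumes "U \<subseteq> F" "f \<in> U" "y \<in> sat U" "y \<in> sat (F - {f})"
  shows "y \<in> sat (U - {f})"
proof (rule ccontr)
  assume y: "y \<notin> sat (U - {f})"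
  have f: "f \<in> F" and af: "a f \<in> carrier \<Gamma>" using assms(1,2) in_carrier by auto
  have Uf: "a ` (R \<union> (U - {f})) \<subseteq> carrier \<Gamma>" "a ` (R \<union> (F - {f})) \<subseteq> carrier \<Gamma>"
    using assms(1) by (auto intro!: image_in_carrier[THEN subsetD])
  have "insert (a f) (a ` (R \<union> (U - {f}))) = a ` (R \<union> U)" using assms(2) by auto
  then have "a f \<in> saturation \<Gamma> (insert y (a ` (R \<union> (U - {f}))))"
    using dom.saturation_exchange[OF Uf(1) af _ y] assms(3) by simp
  moreover have "insert y (a ` (R \<union> (U - {f}))) \<subseteq> sat (F - {f})"
    using assms(4) dom.subset_saturation[OF Uf(2)] assms(1) by auto
  ultimately have "a f \<in> sat (F - {f})"
    using dom.saturation_subset_saturation[OF Uf(2)] by blast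
  then show False using coloops[OF f] by simp
qed

text \<open>Torsion-sensitive independence of the coloops: they create no new relations inside
  \<open>sat U\<close>. The elements of \<open>D\<close> are removed one at a time.\<close>

lemma sat_Int_gen:
  assumes "finite D" "U \<subseteq> F" "D \<subseteq> F - U" "y \<in> sat U" "y \<in> gen (U \<union> D)"
  shows "y \<in> gen U"
  using assms(1,3,5)
proof (induction D)
  case empty
  then show ?case by simp
next
  case (insert f D)
  have f: "f \<in> F" "f \<notin> U \<union> D" and UD: "U \<union> D \<subseteq> F" "U \<union> D \<subseteq> F - {f}"
    using insert assms(2) by auto
  have af: "a f \<in> carrier \<Gamma>" using f in_carrier by auto
  note c = image_in_carrier[OF UD(1)]
  have "insert (a f) (a ` (R \<union> (U \<union> D))) = a ` (R \<union> (U \<union> insert f D))" by auto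
  then have "y \<in> generate \<Gamma> (insert (a f) (a ` (R \<union> (U \<union> D))))" using insert.prems(2) by simp
  then obtain z k where z: "z \<in> gen (U \<union> D)" "y = z \<otimes>\<^bsub>\<Gamma>\<^esub> a f [^]\<^bsub>\<Gamma>\<^esub> (k::int)"
    using dom.generate_Un_singletonE[OF c af] by metis
  have zc: "z \<in> carrier \<Gamma>" using dom.generate_in_carrier[OF c z(1)] .
  \<comment> \<open>A nonzero exponent would place a power of \<open>a f\<close>, hence
    \<open>a f\<close>, in the closure of \<open>F - {f}\<close>.\<close>
  have "k = 0"
  proof (rule ccontr)
    assume "k \<noteq> 0"
    have sg: "subgroup (sat (F - {f})) \<Gamma>" by (rule subgroup_sat) auto
    have "a f [^]\<^bsub>\<Gamma>\<^esub> k = inv\<^bsub>\<Gamma>\<^esub> z \<otimes>\<^bsub>\<Gamma>\<^esub> y"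
      using z(2) zc af by (simp add: dom.m_assoc[symmetric])
    moreover have "z \<in> sat (F - {f})"
      using z(1) gen_subset_sat[OF UD(1)] sat_mono[OF UD(2)] by blast
    moreover have "y \<in> sat (F - {f})" using assms(4) sat_mono[of U "F - {f}"] UD by blast
    ultimately have "a f [^]\<^bsub>\<Gamma>\<^esub> k \<in> sat (F - {f})"
      using subgroup.m_closed[OF sg] subgroup.m_inv_closed[OF sg] by metis
    then have "a f \<in> sat (F - {f})"
      using dom.saturation_closed[OF _ af _ \<open>k \<noteq> 0\<close>] image_in_carrier[of "F - {f}"] by blast
    then show False using coloops[OF f(1)] by simp
  qed
  then have "y \<in> gen (U \<union> D)" using z zc by simp
  then show ?case using insert by blast
qed

text \<open>Loops already lie in the closure of \<open>R\<close>: adding \<open>S\<close> changes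
  the kernel condition on homomorphisms, not their domain.\<close>

lemma sat_Un_loops:
  assumes "U \<subseteq> F" "S \<subseteq> T"
  shows "saturation \<Gamma> (a ` (R \<union> (U \<union> S))) = sat U"
proof
  note c = image_in_carrier[OF assms(1)]
  have "a s \<in> sat U" if "s \<in> S" for s
    using loops[of s] that assms(2) sat_mono[of "{}" U] by auto
  then have "a ` (R \<union> (U \<union> S)) \<subseteq> sat U" using dom.subset_saturation[OF c] by blast
  then show "saturation \<Gamma> (a ` (R \<union> (U \<union> S))) \<subseteq> sat U"
    by (rule dom.saturation_subset_saturation[OF c])
qed (intro dom.saturation_mono image_mono, blast)

lemma sat_homs_restrict_hom:
  assumes "U \<subseteq> F" "\<chi> \<in> M"
  shows "\<chi> \<in> hom (\<Gamma>\<lparr>carrier := sat U\<rparr>) G"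
proof (rule homI)
  have sub: "x \<in> sat F" if "x \<in> sat U" for x using that sat_mono[OF assms(1)] by blast
  show "\<chi> x \<in> carrier G" if "x \<in> carrier (\<Gamma>\<lparr>carrier := sat U\<rparr>)" for x
    using that sat_homs_closed[OF assms(2) sub] by simp
  show "\<chi> (x \<otimes>\<^bsub>\<Gamma>\<lparr>carrier := sat U\<rparr>\<^esub> y) = \<chi> x \<otimes>\<^bsub>G\<^esub> \<chi> y"
    if "x \<in> carrier (\<Gamma>\<lparr>carrier := sat U\<rparr>)" "y \<in> carrier (\<Gamma>\<lparr>carrier := sat U\<rparr>)" for x y
    using that sat_homs_mult[OF assms(2) sub sub] by simp
qed

lemma restrict_hom_in_M:
  assumes "g \<in> hom \<Gamma> G" "\<And>i. i \<in> R \<union> F \<Longrightarrow> g (a i) = \<one>\<^bsub>G\<^esub>"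
  shows "restrict g (sat F) \<in> M"
proof (rule sat_homsI[OF image_in_carrier[OF subset_refl]])
  have sc: "x \<in> carrier \<Gamma>" if "x \<in> sat F" for x
    using that dom.saturation_in_carrier by blast
  show "g x \<in> carrier G" if "x \<in> sat F" for x
    using hom_in_carrier[OF assms(1) sc[OF that]] .
  show "g (x \<otimes>\<^bsub>\<Gamma>\<^esub> y) = g x \<otimes>\<^bsub>G\<^esub> g y" if "x \<in> sat F" "y \<in> sat F" for x y
    using hom_mult[OF assms(1) sc[OF that(1)] sc[OF that(2)]] .
  show "g v = \<one>\<^bsub>G\<^esub>" if "v \<in> a ` (R \<union> F)" for v using that assms(2) by blast
qed

text \<open>Extending \<open>\<phi>\<close> alone might not kill the remaining coloops. Gluing it to
  the trivial map on \<open>gen F\<close> does, and is possible because \<open>sat U\<close> and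
  \<open>gen F\<close> meet in \<open>gen U\<close>, where \<open>\<phi>\<close> vanishes.\<close>

lemma extend_to_M:
  assumes U: "U \<subseteq> F" and S: "S \<subseteq> T" and \<phi>: "\<phi> \<in> sat_homs (a ` (R \<union> (U \<union> S)))"
  obtains \<chi> where "\<chi> \<in> M" "\<And>x. x \<in> sat U \<Longrightarrow> \<chi> x = \<phi> x"
proof -
  have c: "a ` (R \<union> (U \<union> S)) \<subseteq> carrier \<Gamma>" using U S in_carrier by blast
  have \<phi>_hom: "\<phi> \<in> hom (\<Gamma>\<lparr>carrier := sat U\<rparr>) G"
    using \<phi> sat_Un_loops[OF U S] by (simp add: sat_homs_def)
  have triv: "\<phi> x = \<one>\<^bsub>G\<^esub>" if "x \<in> sat U" "x \<in> gen F" for x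
  proof -
    have "x \<in> gen U"
      using sat_Int_gen[of "F - U" U x] finite_F U that by (simp add: Un_absorb1)
    then have "x \<in> generate \<Gamma> (a ` (R \<union> (U \<union> S)))"
      using dom.mono_generate[of "a ` (R \<union> U)" "a ` (R \<union> (U \<union> S))"] by blast
    then show ?thesis by (rule sat_homs_trivial_on_generate[OF c \<phi>])
  qed
  obtain g where g: "g \<in> hom \<Gamma> G" "\<And>x. x \<in> sat U \<Longrightarrow> g x = \<phi> x" "\<And>x. x \<in> gen F \<Longrightarrow> g x = \<one>\<^bsub>G\<^esub>"
    using hom_glue_trivial[OF dv fg subgroup_sat[OF U] subgroup_gen[OF subset_refl] \<phi>_hom triv] by blast
  have "g (a i) = \<one>\<^bsub>G\<^esub>" if "i \<in> R \<union> F" for i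
    using that by (intro g(3) generate.incl) blast
  then have "restrict g (sat F) \<in> M" by (rule restrict_hom_in_M[OF g(1)])
  moreover have "restrict g (sat F) x = \<phi> x" if "x \<in> sat U" for x
  proof -
    have "x \<in> sat F" using that sat_mono[OF U] by blast
    then show ?thesis using g(2)[OF that] by simp
  qed
  ultimately show thesis using that by blast
qed

section \<open>Annihilators, character supports and the factorization of multiplicities\<close>

lemma finite_M: "finite M"
  by (intro finite_sat_homs fg tf image_in_carrier) simp

lemma comm_group_W: "comm_group W"
  by (intro comm_group_sat_hom_group image_in_carrier) simp

lemma mult_W: "x \<in> sat F \<Longrightarrow> (f \<otimes>\<^bsub>W\<^esub> g) x = f x \<otimes>\<^bsub>G\<^esub> g x"
  by (rule mult_sat_hom_group)

lemma inv_W: "f \<in> M \<Longrightarrow> x \<in> sat F \<Longrightarrow> (inv\<^bsub>W\<^esub> f) x = inv\<^bsub>G\<^esub> (f x)"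
  by (intro inv_sat_hom_group image_in_carrier) simp_all

definition annihilator :: "'i set \<Rightarrow> ('a \<Rightarrow> 'c) set" where
  "annihilator U = {\<chi> \<in> M. \<forall>x\<in>sat U. \<chi> x = \<one>\<^bsub>G\<^esub>}"

definition killing :: "'i set \<Rightarrow> ('a \<Rightarrow> 'c) set" where
  "killing S = {\<chi> \<in> M. \<forall>s\<in>S. \<chi> (a s) = \<one>\<^bsub>G\<^esub>}"

lemma subgroup_annihilator:
  assumes "U \<subseteq> F"
  shows "subgroup (annihilator U) W"
proof -
  interpret W: comm_group W by (rule comm_group_W)
  have sub: "x \<in> sat F" if "x \<in> sat U" for x using that sat_mono[OF assms] by blast
  show ?thesis
  proof (rule W.subgroupI)
    have "\<one>\<^bsub>W\<^esub> \<in> annihilator U"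
      using W.one_closed sub by (simp add: annihilator_def one_sat_hom_group)
    then show "annihilator U \<noteq> {}" by blast
    fix f assume f: "f \<in> annihilator U"
    then show "inv\<^bsub>W\<^esub> f \<in> annihilator U"
      using W.inv_closed[of f] sub by (simp add: annihilator_def inv_W)
    fix g assume "g \<in> annihilator U"
    then show "f \<otimes>\<^bsub>W\<^esub> g \<in> annihilator U"
      using f W.m_closed[of f g] sub by (simp add: annihilator_def mult_W)
  qed (auto simp: annihilator_def)
qed

text \<open>Restriction to \<open>sat U\<close> is surjective because \<open>G\<close> is divisible; its fibres are cosets of
  the annihilator of \<open>sat U\<close>.\<close>
lemma card_killing:
  assumes U: "U \<subseteq> F" and S: "S \<subseteq> T"
  shows "card (killing S) = card (annihilator U) * card (sat_homs (a ` (R \<union> (U \<union> S))))"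
proof -
  interpret W: comm_group W by (rule comm_group_W)
  let ?V = "a ` (R \<union> (U \<union> S))"
  have c: "?V \<subseteq> carrier \<Gamma>" using U S in_carrier by blast
  have sub: "x \<in> sat F" if "x \<in> sat U" for x using that sat_mono[OF U] by blast
  have satV: "saturation \<Gamma> ?V = sat U" by (rule sat_Un_loops[OF U S])
  have V_sat: "v \<in> sat U" if "v \<in> ?V" for v
    using that dom.subset_saturation[OF c] satV by blast
  have finB: "finite (sat_homs ?V)" by (intro finite_sat_homs fg tf c)
  have fink: "finite (killing S)" using finite_M by (simp add: killing_def)
  define r where "r \<chi> = restrict \<chi> (sat U)" for \<chi> :: "'a \<Rightarrow> 'c"
  have r: "r \<chi> \<in> sat_homs ?V" if \<chi>: "\<chi> \<in> killing S" for \<chi>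
  proof -
    have M: "\<chi> \<in> M" using \<chi> by (simp add: killing_def)
    have "\<chi> v = \<one>\<^bsub>G\<^esub>" if v: "v \<in> ?V" for v
    proof -
      obtain i where i: "i \<in> R \<union> (U \<union> S)" "v = a i" using v by blast
      show ?thesis
      proof (cases "i \<in> S")
        case True
        then show ?thesis using \<chi> i by (simp add: killing_def)
      next
        case False
        then have "v \<in> a ` (R \<union> F)" using i U by blast
        then show ?thesis using M unfolding sat_homs_def by blast
      qed
    qed
    then have "restrict \<chi> (saturation \<Gamma> ?V) \<in> sat_homs ?V"
      using sat_homs_closed[OF M] sat_homs_mult[OF M] sub
      by (intro sat_homsI[OF c]) (simp_all add: satV)
    then show ?thesis by (simp add: r_def satV)
  qed
  have fiber: "card {\<chi> \<in> killing S. r \<chi> = \<phi>} = card (annihilator U)" if \<phi>: "\<phi> \<in> sat_homs ?V" for \<phi>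
  proof -
    obtain \<chi>0 where \<chi>0: "\<chi>0 \<in> M" "\<And>x. x \<in> sat U \<Longrightarrow> \<chi>0 x = \<phi> x"
      using extend_to_M[OF U S \<phi>] by blast
    have \<phi>_ext: "\<phi> \<in> extensional (sat U)" using \<phi> satV by (simp add: sat_homs_def)
    have r_eq: "r \<chi> = \<phi> \<longleftrightarrow> (\<forall>x\<in>sat U. \<chi> x = \<phi> x)" for \<chi>
    proof
      assume "r \<chi> = \<phi>"
      then show "\<forall>x\<in>sat U. \<chi> x = \<phi> x" by (auto simp: r_def)
    next
      assume *: "\<forall>x\<in>sat U. \<chi> x = \<phi> x"
      show "r \<chi> = \<phi>"
        by (rule extensionalityI[OF _ \<phi>_ext]) (simp_all add: r_def *)
    qed
    \<comment> \<open>The loops in \<open>S\<close> lie in \<open>sat U\<close>, so agreement with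
      \<open>\<phi>\<close> there already forces \<open>\<chi>\<close> to kill
      \<open>S\<close>.\<close>
    have kill: "\<chi> \<in> killing S" if "\<chi> \<in> M" "\<forall>x\<in>sat U. \<chi> x = \<phi> x" for \<chi>
    proof -
      have "\<chi> (a s) = \<one>\<^bsub>G\<^esub>" if s: "s \<in> S" for s
      proof -
        have sV: "a s \<in> ?V" using s by blast
        have "a s \<in> sat U" by (rule V_sat[OF sV])
        moreover have "\<phi> (a s) = \<one>\<^bsub>G\<^esub>" using \<phi> sV unfolding sat_homs_def by blast
        ultimately show ?thesis using \<open>\<forall>x\<in>sat U. \<chi> x = \<phi> x\<close> by simp
      qed
      then show ?thesis using that by (simp add: killing_def)
    qed
    have inv_M: "inv\<^bsub>W\<^esub> \<chi>0 \<in> M" using W.inv_closed[of \<chi>0] \<chi>0(1) by simp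
    have "bij_betw (\<lambda>\<psi>. \<psi> \<otimes>\<^bsub>W\<^esub> \<chi>0) (annihilator U) {\<chi> \<in> killing S. r \<chi> = \<phi>}"
    proof (rule bij_betw_byWitness[where f' = "\<lambda>\<chi>. \<chi> \<otimes>\<^bsub>W\<^esub> inv\<^bsub>W\<^esub> \<chi>0"])
      show "\<forall>\<psi>\<in>annihilator U. \<psi> \<otimes>\<^bsub>W\<^esub> \<chi>0 \<otimes>\<^bsub>W\<^esub> inv\<^bsub>W\<^esub> \<chi>0 = \<psi>"
        using \<chi>0(1) inv_M by (simp add: annihilator_def W.m_assoc)
      show "\<forall>\<chi>\<in>{\<chi> \<in> killing S. r \<chi> = \<phi>}. \<chi> \<otimes>\<^bsub>W\<^esub> inv\<^bsub>W\<^esub> \<chi>0 \<otimes>\<^bsub>W\<^esub> \<chi>0 = \<chi>"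
        using \<chi>0(1) inv_M by (simp add: killing_def W.m_assoc)
      show "(\<lambda>\<psi>. \<psi> \<otimes>\<^bsub>W\<^esub> \<chi>0) ` annihilator U \<subseteq> {\<chi> \<in> killing S. r \<chi> = \<phi>}"
      proof (intro image_subsetI)
        fix \<psi> assume \<psi>: "\<psi> \<in> annihilator U"
        have "\<psi> \<otimes>\<^bsub>W\<^esub> \<chi>0 \<in> M" using W.m_closed[of \<psi> \<chi>0] \<psi> \<chi>0(1) by (simp add: annihilator_def)
        moreover have "\<forall>x\<in>sat U. (\<psi> \<otimes>\<^bsub>W\<^esub> \<chi>0) x = \<phi> x"
          using \<psi> \<chi>0(2) sub sat_homs_closed[OF \<chi>0(1)]
          by (auto simp: annihilator_def mult_W simp flip: \<chi>0(2))
        ultimately show "\<psi> \<otimes>\<^bsub>W\<^esub> \<chi>0 \<in> {\<chi> \<in> killing S. r \<chi> = \<phi>}" using kill r_eq by simp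
      qed
      show "(\<lambda>\<chi>. \<chi> \<otimes>\<^bsub>W\<^esub> inv\<^bsub>W\<^esub> \<chi>0) ` {\<chi> \<in> killing S. r \<chi> = \<phi>} \<subseteq> annihilator U"
      proof (intro image_subsetI)
        fix \<chi> assume "\<chi> \<in> {\<chi> \<in> killing S. r \<chi> = \<phi>}"
        then have \<chi>: "\<chi> \<in> M" "\<forall>x\<in>sat U. \<chi> x = \<phi> x" using r_eq by (auto simp: killing_def)
        have "\<chi> \<otimes>\<^bsub>W\<^esub> inv\<^bsub>W\<^esub> \<chi>0 \<in> M"
          using W.m_closed[of \<chi> "inv\<^bsub>W\<^esub> \<chi>0"] W.inv_closed[of \<chi>0] \<chi>(1) \<chi>0(1) by simp
        moreover have "(\<chi> \<otimes>\<^bsub>W\<^esub> inv\<^bsub>W\<^esub> \<chi>0) x = \<one>\<^bsub>G\<^esub>" if "x \<in> sat U" for x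
          using \<chi>(2) \<chi>0 that sub[OF that] sat_homs_closed[OF \<chi>0(1) sub[OF that]]
          by (simp add: mult_W inv_W)
        ultimately show "\<chi> \<otimes>\<^bsub>W\<^esub> inv\<^bsub>W\<^esub> \<chi>0 \<in> annihilator U" by (simp add: annihilator_def)
      qed
    qed
    then show ?thesis by (rule bij_betw_same_card[symmetric])
  qed
  have "{\<chi> \<in> killing S. r \<chi> \<in> sat_homs ?V} = killing S" using r by blast
  then have "card (killing S) = (\<Sum>\<phi>\<in>sat_homs ?V. card {\<chi> \<in> killing S. r \<chi> = \<phi>})"
    using card_eq_sum_fibers[OF fink finB, of r] by simp
  also have "\<dots> = (\<Sum>\<phi>\<in>sat_homs ?V. card (annihilator U))"
    by (intro sum.cong refl fiber)
  finally show ?thesis by (simp add: mult.commute)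
qed

text \<open>Glue \<open>\<chi>\<close> on \<open>?H\<close> to the trivial map on \<open>?K\<close>.
  An element l z of both has z in \<open>?H\<close>, so l lies in \<open>sat U\<close> and in
  \<open>?H\<close>, hence in \<open>sat (U - {f})\<close>, where \<open>\<chi>\<close> vanishes.
  The glued map gives \<open>\<psi>\<close>, and the quotient of \<open>\<chi>\<close> by
  \<open>\<psi>\<close> is trivial on \<open>?H\<close>.\<close>

lemma annihilator_Diff_singleton:
  assumes U: "U \<subseteq> F" and f: "f \<in> U" and \<chi>: "\<chi> \<in> annihilator (U - {f})"
  obtains \<psi> \<omega> where "\<psi> \<in> annihilator U" "\<omega> \<in> annihilator (F - {f})" "\<chi> = \<psi> \<otimes>\<^bsub>W\<^esub> \<omega>"
proof -
  interpret W: comm_group W by (rule comm_group_W)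
  let ?H = "sat (F - {f})" and ?K = "sat U <#>\<^bsub>\<Gamma>\<^esub> gen (F - {f})"
  have M: "\<chi> \<in> M" using \<chi> by (simp add: annihilator_def)
  have Ff: "F - {f} \<subseteq> F" by blast
  have sH: "subgroup ?H \<Gamma>" by (rule subgroup_sat[OF Ff])
  have sK: "subgroup ?K \<Gamma>"
    by (rule dom.mult_subgroups[OF subgroup_sat[OF U] subgroup_gen[OF Ff]])
  have triv: "\<chi> h = \<one>\<^bsub>G\<^esub>" if h: "h \<in> ?H" "h \<in> ?K" for h
  proof -
    obtain l z where lz: "l \<in> sat U" "z \<in> gen (F - {f})" "h = l \<otimes>\<^bsub>\<Gamma>\<^esub> z"
      using h(2) by (auto simp: set_mult_def)
    have lc: "l \<in> carrier \<Gamma>" "z \<in> carrier \<Gamma>"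
      using lz(1) dom.saturation_in_carrier dom.generate_in_carrier[OF image_in_carrier[OF Ff] lz(2)]
      by blast+
    have zH: "z \<in> ?H" using lz(2) gen_subset_sat[OF Ff] by blast
    have "l = h \<otimes>\<^bsub>\<Gamma>\<^esub> inv\<^bsub>\<Gamma>\<^esub> z" unfolding lz(3) using lc by (simp add: dom.m_assoc)
    then have "l \<in> ?H"
      using subgroup.m_closed[OF sH h(1) subgroup.m_inv_closed[OF sH zH]] by simp
    then have "l \<in> sat (U - {f})" by (rule sat_Diff_singleton[OF U f lz(1)])
    then have "\<chi> l = \<one>\<^bsub>G\<^esub>" using \<chi> by (simp add: annihilator_def)
    moreover have "\<chi> z = \<one>\<^bsub>G\<^esub>"
      using sat_homs_trivial_on_generate[OF image_in_carrier[OF subset_refl] M] lz(2) gen_mono[OF Ff] by blast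
    moreover have "l \<in> sat F" "z \<in> sat F" using lz(1) sat_mono[OF U] zH sat_mono[OF Ff] by blast+
    ultimately show ?thesis unfolding lz(3) using sat_homs_mult[OF M] by simp
  qed
  obtain g where g: "g \<in> hom \<Gamma> G" "\<And>x. x \<in> ?H \<Longrightarrow> g x = \<chi> x" "\<And>x. x \<in> ?K \<Longrightarrow> g x = \<one>\<^bsub>G\<^esub>"
    using hom_glue_trivial[OF dv fg sH sK sat_homs_restrict_hom[OF Ff M] triv] by blast
  have satK: "x \<in> ?K" if x: "x \<in> sat U" for x
  proof -
    have "x = x \<otimes>\<^bsub>\<Gamma>\<^esub> \<one>\<^bsub>\<Gamma>\<^esub>" using x dom.saturation_in_carrier by fastforce
    then show ?thesis using x generate.one unfolding set_mult_def by fast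
  qed
  have genK: "x \<in> ?K" if x: "x \<in> gen (F - {f})" for x
  proof -
    have "x = \<one>\<^bsub>\<Gamma>\<^esub> \<otimes>\<^bsub>\<Gamma>\<^esub> x"
      using dom.generate_in_carrier[OF image_in_carrier[OF Ff] x] by simp
    then show ?thesis using x subgroup.one_closed[OF subgroup_sat[OF U]] unfolding set_mult_def by fast
  qed
  define \<psi> where "\<psi> = restrict g (sat F)"
  \<comment> \<open>All these elements lie in \<open>?K\<close>: \<open>a f\<close> through
    \<open>sat U\<close>, since \<open>f\<close> is in \<open>U\<close>, the others through
    \<open>gen (F - {f})\<close>.\<close>
  have "g (a i) = \<one>\<^bsub>G\<^esub>" if i: "i \<in> R \<union> F" for i
  proof (cases "i = f")
    case True
    then have "a i \<in> a ` (R \<union> U)" using f by blast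
    then have "a i \<in> sat U" using dom.subset_saturation[OF image_in_carrier[OF U]] by blast
    then show ?thesis by (intro g(3) satK)
  next
    case False
    then have "a i \<in> gen (F - {f})" using i by (intro generate.incl) blast
    then show ?thesis by (intro g(3) genK)
  qed
  then have \<psi>M: "\<psi> \<in> M" unfolding \<psi>_def by (rule restrict_hom_in_M[OF g(1)])
  have subF: "x \<in> sat F" if "x \<in> sat U \<or> x \<in> ?H" for x
    using that sat_mono[OF U] sat_mono[OF Ff] by blast
  have "\<psi> \<in> annihilator U"
    using \<psi>M g(3)[OF satK] subF by (simp add: annihilator_def \<psi>_def)
  moreover have "inv\<^bsub>W\<^esub> \<psi> \<otimes>\<^bsub>W\<^esub> \<chi> \<in> annihilator (F - {f})"
  proof -
    have "inv\<^bsub>W\<^esub> \<psi> \<otimes>\<^bsub>W\<^esub> \<chi> \<in> M" using W.m_closed W.inv_closed \<psi>M M by simp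
    moreover have "(inv\<^bsub>W\<^esub> \<psi> \<otimes>\<^bsub>W\<^esub> \<chi>) x = \<one>\<^bsub>G\<^esub>" if x: "x \<in> ?H" for x
    proof -
      have xF: "x \<in> sat F" using subF x by blast
      have "\<psi> x = \<chi> x" using g(2)[OF x] xF by (simp add: \<psi>_def)
      then show ?thesis using sat_homs_closed[OF M xF] \<psi>M xF by (simp add: mult_W inv_W)
    qed
    ultimately show ?thesis by (simp add: annihilator_def)
  qed
  moreover have "\<chi> = \<psi> \<otimes>\<^bsub>W\<^esub> (inv\<^bsub>W\<^esub> \<psi> \<otimes>\<^bsub>W\<^esub> \<chi>)"
    using \<psi>M M W.m_assoc[of \<psi> "inv\<^bsub>W\<^esub> \<psi>" \<chi>] W.inv_closed[of \<psi>] by simp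
  ultimately show thesis using that by blast
qed

text \<open>The coloops are tested one by one, on the homomorphisms trivial on the closure of all
  the others.\<close>

definition char_support :: "(('a \<Rightarrow> 'c) \<Rightarrow> complex) \<Rightarrow> 'i set" where
  "char_support \<zeta> = {f \<in> F. \<exists>\<chi>\<in>annihilator (F - {f}). \<zeta> \<chi> \<noteq> 1}"

lemma annihilator_antimono: "U \<subseteq> U' \<Longrightarrow> annihilator U' \<subseteq> annihilator U"
  using sat_mono[of U U'] unfolding annihilator_def by blast

text \<open>By repeated splitting, \<open>annihilator U\<close> is generated by the groups
  \<open>annihilator (F - {f})\<close> with \<open>f\<close> in \<open>F - U\<close>, so testing on
  these suffices.\<close>

lemma char_trivial_on_annihilator_iff:
  assumes U: "U \<subseteq> F" and \<zeta>: "\<zeta> \<in> hom W complex_units"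
  shows "(\<forall>\<chi>\<in>annihilator U. \<zeta> \<chi> = 1) \<longleftrightarrow> char_support \<zeta> \<subseteq> U"
proof
  assume *: "\<forall>\<chi>\<in>annihilator U. \<zeta> \<chi> = 1"
  show "char_support \<zeta> \<subseteq> U"
  proof
    fix f assume "f \<in> char_support \<zeta>"
    then obtain \<chi> where \<chi>: "\<chi> \<in> annihilator (F - {f})" "\<zeta> \<chi> \<noteq> 1" by (auto simp: char_support_def)
    show "f \<in> U"
    proof (rule ccontr)
      assume "f \<notin> U"
      then have "annihilator (F - {f}) \<subseteq> annihilator U" using U by (intro annihilator_antimono) blast
      then show False using \<chi> * by blast
    qed
  qed
next
  assume sup: "char_support \<zeta> \<subseteq> U"
  interpret W: comm_group W by (rule comm_group_W)
  interpret \<zeta>: group_hom W complex_units \<zeta>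
    using \<zeta> comm_group_complex_units comm_group.axioms(2) W.is_group
    by (auto simp: group_hom_def group_hom_axioms_def)
  \<comment> \<open>Induction on the complement of \<open>U\<close>, starting from
    \<open>annihilator F\<close>, which is trivial.\<close>
  have "D \<subseteq> F - U \<Longrightarrow> \<forall>\<chi>\<in>annihilator (F - D). \<zeta> \<chi> = 1" if "finite D" for D
    using that
  proof (induction D)
    case empty
    have "\<chi> = \<one>\<^bsub>W\<^esub>" if "\<chi> \<in> annihilator F" for \<chi>
      using that W.one_closed by (intro sat_homs_eqI) (auto simp: annihilator_def one_sat_hom_group)
    then have "\<zeta> \<chi> = 1" if "\<chi> \<in> annihilator F" for \<chi>
      using that \<zeta>.hom_one by fastforce
    then show ?case by simp
  next
    case (insert f D)
    show ?case
    proof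
      fix \<chi> assume "\<chi> \<in> annihilator (F - insert f D)"
      moreover have "F - insert f D = F - D - {f}" by blast
      ultimately have \<chi>: "\<chi> \<in> annihilator (F - D - {f})" by simp
      have "f \<in> F - D" using insert by blast
      then obtain \<psi> \<omega> where s: "\<psi> \<in> annihilator (F - D)" "\<omega> \<in> annihilator (F - {f})" "\<chi> = \<psi> \<otimes>\<^bsub>W\<^esub> \<omega>"
        using annihilator_Diff_singleton[OF Diff_subset _ \<chi>] by blast
      have "f \<notin> char_support \<zeta>" using insert.prems sup by blast
      then have "\<zeta> \<omega> = 1" using s(2) insert.prems by (auto simp: char_support_def)
      moreover have "\<zeta> \<psi> = 1" using s(1) insert by blast
      moreover have "\<psi> \<in> M" "\<omega> \<in> M" using s by (auto simp: annihilator_def)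
      ultimately show "\<zeta> \<chi> = 1" unfolding s(3) using \<zeta>.hom_mult[of \<psi> \<omega>] by simp
    qed
  qed
  from this[of "F - U"] show "\<forall>\<chi>\<in>annihilator U. \<zeta> \<chi> = 1"
    using finite_F U by (simp add: double_diff)
qed

text \<open>Take N = #M; \<open>p A\<close> counts the characters of \<open>W\<close> with support
  \<open>A\<close>, and \<open>q B\<close> counts the homomorphisms in \<open>M\<close> whose set of
  killed loops is exactly \<open>B\<close>.\<close>

lemma ex_factorization:
  "\<exists>N p q. N > (0::nat) \<and> (\<forall>U\<subseteq>F. \<forall>S\<subseteq>T. N * card (sat_homs (a ` (R \<union> (U \<union> S)))) =
     (\<Sum>A\<in>Pow U. p A) * (\<Sum>B | S \<subseteq> B \<and> B \<subseteq> T. q B))"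
proof -
  interpret W: comm_group W by (rule comm_group_W)
  have finW: "finite (carrier W)" using finite_M by simp
  define Z where "Z = chars_trivial_on W {}"
  have finZ: "finite Z" unfolding Z_def by (rule finite_chars_trivial_on[OF comm_group_W finW])
  define vanish where "vanish \<chi> = {t \<in> T. \<chi> (a t) = \<one>\<^bsub>G\<^esub>}" for \<chi>
  define p where "p A = card {\<zeta> \<in> Z. char_support \<zeta> = A}" for A
  define q where "q B = card {\<chi> \<in> M. vanish \<chi> = B}" for B
  have "card M * card (sat_homs (a ` (R \<union> (U \<union> S)))) =
     (\<Sum>A\<in>Pow U. p A) * (\<Sum>B | S \<subseteq> B \<and> B \<subseteq> T. q B)" if U: "U \<subseteq> F" and S: "S \<subseteq> T" for U S
  proof -
    have "chars_trivial_on W (annihilator U) = {\<zeta> \<in> Z. char_support \<zeta> \<in> Pow U}"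
      using char_trivial_on_annihilator_iff[OF U] by (auto simp: chars_trivial_on_def Z_def)
    then have cz: "card (chars_trivial_on W (annihilator U)) = (\<Sum>A\<in>Pow U. p A)"
      using card_eq_sum_fibers[OF finZ, of "Pow U" char_support] finite_subset[OF U finite_F]
      by (simp add: p_def)
    have "killing S = {\<chi> \<in> M. vanish \<chi> \<in> {B. S \<subseteq> B \<and> B \<subseteq> T}}"
      using S by (auto simp: killing_def vanish_def)
    moreover have "finite {B. S \<subseteq> B \<and> B \<subseteq> T}" using finite_T by simp
    ultimately have ck: "card (killing S) = (\<Sum>B | S \<subseteq> B \<and> B \<subseteq> T. q B)"
      using card_eq_sum_fibers[OF finite_M, of "{B. S \<subseteq> B \<and> B \<subseteq> T}" vanish] by (simp add: q_def)
    have "card M = card (annihilator U) * (\<Sum>A\<in>Pow U. p A)"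
      using card_chars_trivial_on[OF comm_group_W finW subgroup_annihilator[OF U]] cz by simp
    then show ?thesis using card_killing[OF U S] ck by simp
  qed
  moreover have "card M > 0" using finite_M W.one_closed by (auto simp: card_gt_0_iff)
  ultimately show ?thesis
    by (intro exI[of _ "card M"] exI[of _ p] exI[of _ q]) simp
qed

end

section \<open>Positivity of the G-Tutte polynomial\<close>

text \<open>Finiteness is recorded because \<open>card\<close> of an infinite set is 0: it certifies
  that \<open>mult_m\<close> is a genuine count.\<close>

lemma (in comm_group_pair) hom_tor_finite_and_card:
  assumes "fin_gen \<Gamma>" "torsionwise_finite G" "(!) A ` S \<subseteq> carrier \<Gamma>"
  shows "finite (hom_tor \<Gamma> A G S)" "mult_m \<Gamma> A G S = card (sat_homs ((!) A ` S))"
proof -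
  obtain h where h: "bij_betw h (hom_tor \<Gamma> A G S) (sat_homs ((!) A ` S))"
    using ex_bij_hom_torsion_part[OF assms(3)] unfolding hom_tor_def sub_gen_def Let_def by blast
  show "finite (hom_tor \<Gamma> A G S)"
    using bij_betw_finite[OF h] finite_sat_homs[OF assms] by simp
  show "mult_m \<Gamma> A G S = card (sat_homs ((!) A ` S))"
    using bij_betw_same_card[OF h] by (simp add: mult_m_def)
qed

lemma (in comm_group_pair) multiplicity_matroid_list:
  assumes "fin_gen \<Gamma>" "torsionwise_finite G" "divisible_group G" "set A \<subseteq> carrier \<Gamma>"
  shows "multiplicity_matroid {0..<length A} (rk \<Gamma> A) (\<lambda>e S. A ! e \<in> saturation \<Gamma> ((!) A ` S)) (mult_m \<Gamma> A G)"
proof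
  have c: "(!) A ` S \<subseteq> carrier \<Gamma>" if "S \<subseteq> {0..<length A}" for S
    using assms(4) that by (auto simp: subset_iff)
  show "finite {0..<length A}" by simp
  show "rk \<Gamma> A (insert e S) = rk \<Gamma> A S + (if A ! e \<in> saturation \<Gamma> ((!) A ` S) then 0 else 1)"
    if "e \<in> {0..<length A}" "S \<subseteq> {0..<length A}" for e S
  proof -
    have "finite ((!) A ` S)" using that(2) finite_subset by blast
    moreover have "A ! e \<in> carrier \<Gamma>" using c[of "{e}"] that(1) by simp
    ultimately show ?thesis
      using dom.group_rank_insert[OF _ c[OF that(2)]] by (simp add: rk_def)
  qed
  show "A ! e \<in> saturation \<Gamma> ((!) A ` S')"
    if "A ! e \<in> saturation \<Gamma> ((!) A ` S)" "S \<subseteq> S'" for e S S'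
    using that(1) dom.saturation_mono[OF image_mono[OF that(2)]] by blast
  show "\<exists>N p q. N > (0::nat) \<and> (\<forall>U\<subseteq>F. \<forall>S\<subseteq>T. N * mult_m \<Gamma> A G (R \<union> (U \<union> S)) =
      (\<Sum>B\<in>Pow U. p B) * (\<Sum>B | S \<subseteq> B \<and> B \<subseteq> T. q B))"
    if RFT: "R \<union> F \<union> T \<subseteq> {0..<length A}"
      and T: "\<And>t. t \<in> T \<Longrightarrow> A ! t \<in> saturation \<Gamma> ((!) A ` R)"
      and F: "\<And>f. f \<in> F \<Longrightarrow> A ! f \<notin> saturation \<Gamma> ((!) A ` (R \<union> (F - {f})))" for R F T
  proof -
    interpret mol: molecule_homs \<Gamma> G "(!) A" R F T
    proof
      show "finite F" "finite T" using RFT finite_subset[of _ "{0..<length A}"] by auto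
    qed (use assms T F c[OF RFT] in simp_all)
    have m: "mult_m \<Gamma> A G (R \<union> (U \<union> S)) = card (sat_homs ((!) A ` (R \<union> (U \<union> S))))"
      if "U \<subseteq> F" "S \<subseteq> T" for U S
      using that RFT by (intro hom_tor_finite_and_card(2) assms c) blast
    obtain N p q where N: "N > (0::nat)" "\<forall>U\<subseteq>F. \<forall>S\<subseteq>T. N * card (sat_homs ((!) A ` (R \<union> (U \<union> S)))) =
        (\<Sum>B\<in>Pow U. p B) * (\<Sum>B | S \<subseteq> B \<and> B \<subseteq> T. q B)"
      using mol.ex_factorization by (elim exE conjE)
    then have "\<forall>U\<subseteq>F. \<forall>S\<subseteq>T. N * mult_m \<Gamma> A G (R \<union> (U \<union> S)) =
        (\<Sum>B\<in>Pow U. p B) * (\<Sum>B | S \<subseteq> B \<and> B \<subseteq> T. q B)"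
      by (simp add: m)
    with N(1) show ?thesis by (intro exI[of _ N] exI[of _ p] exI[of _ q] conjI)
  qed
qed

theorem mainTheorem18:
  fixes \<Gamma> :: "('a, 'b) monoid_scheme" and G :: "('c, 'd) monoid_scheme" and A :: "'a list"
  assumes "comm_group \<Gamma>" and "fin_gen \<Gamma>" and "set A \<subseteq> carrier \<Gamma>"
    and "comm_group G" and "torsionwise_finite G" and "divisible_group G"
  shows "(\<forall>S \<subseteq> {0..<length A}. finite (hom_tor \<Gamma> A G S)) \<and> (\<forall>i j. coeff (coeff (G_tutte \<Gamma> G A) j) i \<ge> 0)"
proof (intro conjI allI impI)
  interpret comm_group_pair \<Gamma> G using assms by (simp add: comm_group_pair_def)
  fix S assume "S \<subseteq> {0..<length A}"
  then have "(!) A ` S \<subseteq> carrier \<Gamma>" using assms(3) by (auto simp: subset_iff)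
  then show "finite (hom_tor \<Gamma> A G S)" by (rule hom_tor_finite_and_card(1)[OF assms(2,5)])
next
  interpret comm_group_pair \<Gamma> G using assms by (simp add: comm_group_pair_def)
  interpret multiplicity_matroid "{0..<length A}" "rk \<Gamma> A"
      "\<lambda>e S. A ! e \<in> saturation \<Gamma> ((!) A ` S)" "mult_m \<Gamma> A G"
    by (rule multiplicity_matroid_list[OF assms(2,5,6,3)])
  \<comment> \<open>With rank 0 for the empty list, the nullity exponent in
    \<open>minor_term\<close> for \<open>R\<close> = {} is the one in
    \<open>G_tutte\<close>.\<close>
  have "rk \<Gamma> A {} = 0" by (simp add: rk_def dom.group_rank_empty)
  then have "G_tutte \<Gamma> G A = minor_tutte {} {0..<length A}"
    by (simp add: G_tutte_def minor_tutte_def minor_term_def)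
  moreover have "nonneg_coeffs (minor_tutte {} {0..<length A})"
    by (rule nonneg_coeffs_minor_tutte) simp_all
  ultimately show "coeff (coeff (G_tutte \<Gamma> G A) j) i \<ge> 0" for i j
    by (simp add: nonneg_coeffs_def)
qed

end
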